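(* Let $F$ be a field of characteristic $p>0$ and let $\lambda$ be a partition of $n+1$. Let $\lambda_1,\dots,\lambda_m$ be the partitions of $n$ obtained by removing the $1$st, ..., $m$-th removable node of $[\lambda]$ (numbered from top to bottom), and let $0=S_0^\lambda\subset S_1^\lambda\subset\cdots\subset S_m^\lambda=S_F^\lambda$ be the Specht series of $S_F^\lambda{\downarrow_{\Sigma_n}}$, so that $S^\lambda_i/S^\lambda_{i-1}\cong S_F^{\lambda_i}$. Suppose that $\alpha=\lambda_u$ and $\beta=\lambda_v$ with $\alpha\unrhd\beta$ (dominance order), and that the removed nodes $[\lambda]\setminus[\alpha]$ and $[\lambda]\setminus[\beta]$ have the same $p$-residue. Identify $S_F^\alpha=S^\lambda_u/S^\lambda_{u-1}$ and $S_F^\beta=S^\lambda_v/S^\lambda_{v-1}$ as subquotients of $S_F^\lambda{\downarrow_{\Sigma_n}}$. Then there is a polynomial $f\in F[x]$ such that multiplication by $f(L_{n+1})$ induces a non-zero $F\Sigma_n$-homomorphism $S_F^\alpha\to S_F^\beta$; that is, $S_u^\lambda f(L_{n+1})\subseteq S_v^\lambda$, $S_{u-1}^\lambda f(L_{n+1})\subseteq S_{v-1}^\lambda$, and the induced map $S_u^\lambda/S_{u-1}^\lambda\to S_v^\lambda/S_{v-1}^\lambda$ is non-zero.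
   Context: $\Sigma_n$ is the symmetric group on $\{1,\dots,n\}$, embedded in $\Sigma_{n+1}$ as the stabilizer of $n+1$; modules are right modules. $S_F^\lambda$ is the Specht module of James over $F$ (the span of the polytabloids $e_s$ inside the permutation module on $\lambda$-tabloids). $L_{n+1}=\sum_{i=1}^n (i,n+1)\in F\Sigma_{n+1}$ is the Jucys-Murphy element; it commutes with $\Sigma_n$. The residue of the node in row $i$ and column $j$ of a Young diagram is $j-i$, and its $p$-residue is $j-i$ modulo $p$. $S_i^\lambda$ denotes the subspace of $S_F^\lambda$ spanned by those polytabloids $e_s$ where $s$ is a standard $\lambda$-tableau in which $n+1$ occupies one of the first $i$ removable nodes of $[\lambda]$; it is a known fact (James) that $S_i^\lambda$ is an $F\Sigma_n$-submodule with $S_i^\lambda/S_{i-1}^\lambda\cong S_F^{\lambda_i}$. *)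

theory Defs
  imports
    "HOL-Library.Poly_Mapping"
    "HOL-Combinatorics.Combinatorics"
    "HOL-Computational_Algebra.Computational_Algebra"
    "HOL-Number_Theory.Cong"
begin

section \<open>Group algebras of symmetric groups and their right modules\<close>

text \<open>
  For a field \<open>'a\<close>, the type \<open>'b \<Rightarrow>\<^sub>0 'a\<close> of finitely supported functions is the vector
  space with basis \<open>'b\<close>; the basis vector of \<open>b\<close> is \<open>Poly_Mapping.single b 1\<close>.
\<close>

definition scale_pm :: "'a::field \<Rightarrow> ('b \<Rightarrow>\<^sub>0 'a) \<Rightarrow> ('b \<Rightarrow>\<^sub>0 'a)" where
  "scale_pm c x = Poly_Mapping.map ((*) c) x"

lemma lookup_scale_pm: "Poly_Mapping.lookup (scale_pm c x) b = c * Poly_Mapping.lookup x b"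
  by (simp add: scale_pm_def map.rep_eq when_def)

interpretation fvs: vector_space "scale_pm :: 'a::field \<Rightarrow> ('b \<Rightarrow>\<^sub>0 'a) \<Rightarrow> ('b \<Rightarrow>\<^sub>0 'a)"
  by unfold_locales
    (rule poly_mapping_eqI; simp add: lookup_scale_pm lookup_add algebra_simps)+

text \<open>
  Permutations act from the right, \<open>i(\<sigma>\<tau>) = (i\<sigma>)\<tau>\<close>, so that the product of \<open>\<sigma>\<close> and \<open>\<tau>\<close>
  in the group is the function \<open>\<tau> \<circ> \<sigma>\<close>.
\<close>

type_synonym 'a group_alg = "(nat \<Rightarrow> nat) \<Rightarrow>\<^sub>0 'a"

definition ga_mult :: "'a::field group_alg \<Rightarrow> 'a group_alg \<Rightarrow> 'a group_alg" where
  "ga_mult a b = (\<Sum>\<sigma>\<in>Poly_Mapping.keys a. \<Sum>\<tau>\<in>Poly_Mapping.keys b.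
     Poly_Mapping.single (\<tau> \<circ> \<sigma>) (Poly_Mapping.lookup a \<sigma> * Poly_Mapping.lookup b \<tau>))"

primrec ga_power :: "'a::field group_alg \<Rightarrow> nat \<Rightarrow> 'a group_alg" where
  "ga_power a 0 = Poly_Mapping.single id 1"
| "ga_power a (Suc k) = ga_mult (ga_power a k) a"

definition ga_poly :: "'a::field poly \<Rightarrow> 'a group_alg \<Rightarrow> 'a group_alg" where
  "ga_poly f a = (\<Sum>k\<le>degree f. scale_pm (coeff f k) (ga_power a k))"

definition sym_group_alg :: "nat \<Rightarrow> 'a::field group_alg set" where
  "sym_group_alg n = {a. \<forall>\<sigma>\<in>Poly_Mapping.keys a. \<sigma> permutes {1..n}}"

text \<open>The Jucys-Murphy element \<open>L\<^sub>k\<close>, the sum of the transpositions \<open>(i, k)\<close> for \<open>1 \<le> i < k\<close>.\<close>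

definition jucys_murphy :: "nat \<Rightarrow> 'a::field group_alg" where
  "jucys_murphy k = (\<Sum>i\<in>{1..<k}. Poly_Mapping.single (transpose i k) 1)"

section \<open>Partitions, diagrams, tableaux\<close>

text \<open>
  A partition is given by its sequence of row lengths, padded with zeros.  Rows and columns are
  numbered from 0, which does not affect the residue (column minus row) of a node.
\<close>

type_synonym node = "nat \<times> nat"

definition partition_of :: "nat \<Rightarrow> (nat \<Rightarrow> nat) \<Rightarrow> bool" where
  "partition_of N lam \<longleftrightarrow> antimono lam \<and> finite {i. lam i \<noteq> 0} \<and> (\<Sum>i | lam i \<noteq> 0. lam i) = N"

definition diagram :: "(nat \<Rightarrow> nat) \<Rightarrow> node set" where
  "diagram lam = {(i, j). j < lam i}"

definition residue :: "node \<Rightarrow> int" where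
  "residue x = int (snd x) - int (fst x)"

definition dominates :: "(nat \<Rightarrow> nat) \<Rightarrow> (nat \<Rightarrow> nat) \<Rightarrow> bool" where
  "dominates alpha beta \<longleftrightarrow> (\<forall>k. (\<Sum>i<k. beta i) \<le> (\<Sum>i<k. alpha i))"

text \<open>
  The removable nodes are the last nodes of those rows that are longer than the following row.
  They are numbered \<open>1, \<dots>, num_removable lam\<close> from top to bottom.
\<close>

definition removable_rows :: "(nat \<Rightarrow> nat) \<Rightarrow> nat set" where
  "removable_rows lam = {i. lam (Suc i) < lam i}"

definition num_removable :: "(nat \<Rightarrow> nat) \<Rightarrow> nat" where
  "num_removable lam = card (removable_rows lam)"

definition removable_row :: "(nat \<Rightarrow> nat) \<Rightarrow> nat \<Rightarrow> nat" where
  "removable_row lam k = sorted_list_of_set (removable_rows lam) ! (k - 1)"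

definition removable_node :: "(nat \<Rightarrow> nat) \<Rightarrow> nat \<Rightarrow> node" where
  "removable_node lam k = (removable_row lam k, lam (removable_row lam k) - 1)"

definition remove_node :: "(nat \<Rightarrow> nat) \<Rightarrow> nat \<Rightarrow> (nat \<Rightarrow> nat)" where
  "remove_node lam k = lam(removable_row lam k := lam (removable_row lam k) - 1)"

text \<open>
  A tableau takes the junk value 0 outside its diagram; this is preserved by permutations of
  \<open>{1..n}\<close>, which fix 0.
\<close>

type_synonym tableau = "node \<Rightarrow> nat"

definition is_tableau :: "(nat \<Rightarrow> nat) \<Rightarrow> tableau \<Rightarrow> bool" where
  "is_tableau lam t \<longleftrightarrow>
     bij_betw t (diagram lam) {1..card (diagram lam)} \<and> (\<forall>x. x \<notin> diagram lam \<longrightarrow> t x = 0)"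

definition standard_tableau :: "(nat \<Rightarrow> nat) \<Rightarrow> tableau \<Rightarrow> bool" where
  "standard_tableau lam t \<longleftrightarrow> is_tableau lam t \<and>
     (\<forall>i j j'. j < j' \<and> (i, j') \<in> diagram lam \<longrightarrow> t (i, j) < t (i, j')) \<and>
     (\<forall>i i' j. i < i' \<and> (i', j) \<in> diagram lam \<longrightarrow> t (i, j) < t (i', j))"

section \<open>Specht modules\<close>

text \<open>A tabloid is a class of row-equivalent tableaux.\<close>

type_synonym tabloid = "tableau set"

definition tabloid_of :: "(nat \<Rightarrow> nat) \<Rightarrow> tableau \<Rightarrow> tabloid" where
  "tabloid_of lam t = {s. is_tableau lam s \<and> (\<forall>i. s ` {x \<in> diagram lam. fst x = i} = t ` {x \<in> diagram lam. fst x = i})}"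

text \<open>The right action \<open>{t}\<sigma> = {t\<sigma>}\<close> on tabloids, extended bilinearly.\<close>

definition act :: "(tabloid \<Rightarrow>\<^sub>0 'a::field) \<Rightarrow> 'a group_alg \<Rightarrow> (tabloid \<Rightarrow>\<^sub>0 'a)" where
  "act x a = (\<Sum>T\<in>Poly_Mapping.keys x. \<Sum>\<sigma>\<in>Poly_Mapping.keys a.
     Poly_Mapping.single ((\<lambda>t. \<sigma> \<circ> t) ` T) (Poly_Mapping.lookup x T * Poly_Mapping.lookup a \<sigma>))"

definition column_stabilizer :: "(nat \<Rightarrow> nat) \<Rightarrow> tableau \<Rightarrow> (nat \<Rightarrow> nat) set" where
  "column_stabilizer lam t = {\<sigma>. \<sigma> permutes {1..card (diagram lam)} \<and>
     (\<forall>j. \<sigma> ` t ` {x \<in> diagram lam. snd x = j} = t ` {x \<in> diagram lam. snd x = j})}"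

definition signed_column_sum :: "(nat \<Rightarrow> nat) \<Rightarrow> tableau \<Rightarrow> 'a::field group_alg" where
  "signed_column_sum lam t =
     (\<Sum>\<sigma>\<in>column_stabilizer lam t. Poly_Mapping.single \<sigma> (of_int (sign \<sigma>)))"

definition polytabloid :: "(nat \<Rightarrow> nat) \<Rightarrow> tableau \<Rightarrow> (tabloid \<Rightarrow>\<^sub>0 'a::field)" where
  "polytabloid lam t = act (Poly_Mapping.single (tabloid_of lam t) 1) (signed_column_sum lam t)"

definition specht :: "(nat \<Rightarrow> nat) \<Rightarrow> (tabloid \<Rightarrow>\<^sub>0 'a::field) set" where
  "specht lam = fvs.span {polytabloid lam t | t. is_tableau lam t}"

text \<open>
  The subspaces \<open>S\<^sub>i\<close> of the Specht series; for \<open>lam\<close> a partition of \<open>n + 1\<close>, the entry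
  \<open>n + 1\<close> is \<open>card (diagram lam)\<close>.
\<close>

definition specht_series :: "(nat \<Rightarrow> nat) \<Rightarrow> nat \<Rightarrow> (tabloid \<Rightarrow>\<^sub>0 'a::field) set" where
  "specht_series lam i = fvs.span {polytabloid lam s | s. standard_tableau lam s \<and>
     (\<exists>k\<in>{1..i}. s (removable_node lam k) = card (diagram lam))}"

section \<open>Submodules and homomorphisms\<close>

definition sym_submodule :: "nat \<Rightarrow> (tabloid \<Rightarrow>\<^sub>0 'a::field) set \<Rightarrow> bool" where
  "sym_submodule n U \<longleftrightarrow> fvs.subspace U \<and> (\<forall>x\<in>U. \<forall>a\<in>sym_group_alg n. act x a \<in> U)"

text \<open>
  Linearity over the field is the case of scalar multiples of the identity in the last clause.
\<close>

definition sym_hom ::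
  "nat \<Rightarrow> (tabloid \<Rightarrow>\<^sub>0 'a::field) set \<Rightarrow> (tabloid \<Rightarrow>\<^sub>0 'a) set
    \<Rightarrow> ((tabloid \<Rightarrow>\<^sub>0 'a) \<Rightarrow> (tabloid \<Rightarrow>\<^sub>0 'a)) \<Rightarrow> bool" where
  "sym_hom n U V h \<longleftrightarrow> sym_submodule n U \<and> sym_submodule n V \<and> h ` U \<subseteq> V \<and>
     (\<forall>x\<in>U. \<forall>y\<in>U. h (x + y) = h x + h y) \<and>
     (\<forall>x\<in>U. \<forall>a\<in>sym_group_alg n. h (act x a) = act (h x) a)"

text \<open>\<open>h\<close> induces a non-zero homomorphism \<open>U/U' \<rightarrow> V/V'\<close>.\<close>

definition induces_nonzero_hom ::
  "nat \<Rightarrow> (tabloid \<Rightarrow>\<^sub>0 'a::field) set \<Rightarrow> (tabloid \<Rightarrow>\<^sub>0 'a) set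
    \<Rightarrow> (tabloid \<Rightarrow>\<^sub>0 'a) set \<Rightarrow> (tabloid \<Rightarrow>\<^sub>0 'a) set
    \<Rightarrow> ((tabloid \<Rightarrow>\<^sub>0 'a) \<Rightarrow> (tabloid \<Rightarrow>\<^sub>0 'a)) \<Rightarrow> bool" where
  "induces_nonzero_hom n U U' V V' h \<longleftrightarrow>
     U' \<subseteq> U \<and> V' \<subseteq> V \<and> sym_hom n U V h \<and> sym_hom n U' V' h \<and> (\<exists>x\<in>U. h x \<notin> V')"

text \<open>\<open>\<theta>\<close> is an epimorphism with kernel \<open>U'\<close>, and so identifies \<open>U/U'\<close> with \<open>M\<close>.\<close>

definition identifies_quotient ::
  "nat \<Rightarrow> (tabloid \<Rightarrow>\<^sub>0 'a::field) set \<Rightarrow> (tabloid \<Rightarrow>\<^sub>0 'a) set \<Rightarrow> (tabloid \<Rightarrow>\<^sub>0 'a) set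
    \<Rightarrow> ((tabloid \<Rightarrow>\<^sub>0 'a) \<Rightarrow> (tabloid \<Rightarrow>\<^sub>0 'a)) \<Rightarrow> bool" where
  "identifies_quotient n U U' M \<theta> \<longleftrightarrow>
     sym_hom n U M \<theta> \<and> \<theta> ` U = M \<and> U' = {x \<in> U. \<theta> x = 0}"

end

theory Submission
  imports Defs
begin

text \<open>
  The Jucys-Murphy element \<open>L\<close> acts on \<open>S\<^sub>i / S\<^sub>i\<^sub>-\<^sub>1\<close> as multiplication by the residue \<open>c\<^sub>i\<close> of the
  \<open>i\<close>-th removable node.  Dominance gives \<open>v \<le> u\<close>, and \<open>f = (x - c\<^sub>u)\<dots>(x - c\<^sub>v\<^sub>+\<^sub>1)\<close> maps \<open>S\<^sub>u\<close>
  into \<open>S\<^sub>v\<close>; since \<open>c\<^sub>u = c\<^sub>v\<close> in the field, \<open>f\<close> is also \<open>(x - c\<^sub>u\<^sub>-\<^sub>1)\<dots>(x - c\<^sub>v)\<close>, which maps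
  \<open>S\<^sub>u\<^sub>-\<^sub>1\<close> into \<open>S\<^sub>v\<^sub>-\<^sub>1\<close>.

  By a Garnir-type straightening argument, \<open>S\<^sub>i\<close> consists of the elements of the Specht module in whose
  tabloids \<open>n + 1\<close> never lies below the row of the \<open>i\<close>-th removable node, so containments can be read
  off from coefficients.  For a tableau \<open>t\<close> with \<open>n + 1\<close> at the \<open>u\<close>-th removable node, let \<open>T\<close> be the
  tabloid obtained by exchanging \<open>n + 1\<close> successively with the entries at the removable nodes
  \<open>u - 1, \<dots>, v\<close>.  No fewer than \<open>u - v\<close> transpositions \<open>(i, n + 1)\<close> lead from a column permutation
  of \<open>t\<close> to \<open>T\<close>, and exactly one sequence of \<open>u - v\<close> of them does; so \<open>T\<close> has coefficient 1 in
  \<open>e\<^sub>t f(L)\<close>, which is therefore not in \<open>S\<^sub>v\<^sub>-\<^sub>1\<close>.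
\<close>

section \<open>The module structure on tabloids\<close>

lemma lookup_sum_pm: "Poly_Mapping.lookup (\<Sum>i\<in>A. f i) b = (\<Sum>i\<in>A. Poly_Mapping.lookup (f i) b)"
  by (induction A rule: infinite_finite_induct) (simp_all add: lookup_add)

lemma poly_mapping_sum_single:
  "x = (\<Sum>T\<in>Poly_Mapping.keys x. Poly_Mapping.single T (Poly_Mapping.lookup x T))"
  by (rule poly_mapping_eqI)
    (auto simp: lookup_sum_pm lookup_single when_def sum.delta in_keys_iff)

text \<open>The support of a sum can be smaller than the union of the supports; summing over fixed
  finite supersets makes bilinearity of the action a termwise matter.\<close>

lemma act_superset:
  assumes "finite A" "Poly_Mapping.keys x \<subseteq> A" "finite B" "Poly_Mapping.keys a \<subseteq> B"
  shows "act x a = (\<Sum>T\<in>A. \<Sum>\<sigma>\<in>B. Poly_Mapping.single ((\<lambda>t. \<sigma> \<circ> t) ` T)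
    (Poly_Mapping.lookup x T * Poly_Mapping.lookup a \<sigma>))"
proof -
  have "act x a = (\<Sum>T\<in>Poly_Mapping.keys x. \<Sum>\<sigma>\<in>B. Poly_Mapping.single ((\<lambda>t. \<sigma> \<circ> t) ` T)
    (Poly_Mapping.lookup x T * Poly_Mapping.lookup a \<sigma>))"
    unfolding act_def using assms
    by (intro sum.cong refl sum.mono_neutral_left) (auto simp: in_keys_iff)
  also have "\<dots> = (\<Sum>T\<in>A. \<Sum>\<sigma>\<in>B. Poly_Mapping.single ((\<lambda>t. \<sigma> \<circ> t) ` T)
    (Poly_Mapping.lookup x T * Poly_Mapping.lookup a \<sigma>))"
    using assms by (intro sum.mono_neutral_left) (auto simp: in_keys_iff)
  finally show ?thesis .
qed

lemma act_add_left: "act (x + y) a = act x a + act y a"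
  by (simp add: act_superset[of "Poly_Mapping.keys x \<union> Poly_Mapping.keys y" _ "Poly_Mapping.keys a"]
      Poly_Mapping.keys_add lookup_add distrib_right single_add sum.distrib)

lemma act_add_right: "act x (a + b) = act x a + act x b"
  by (simp add: act_superset[of "Poly_Mapping.keys x" _ "Poly_Mapping.keys a \<union> Poly_Mapping.keys b"]
      Poly_Mapping.keys_add lookup_add distrib_left single_add sum.distrib)

lemma act_zero_left [simp]: "act 0 a = 0" and act_zero_right [simp]: "act x 0 = 0"
  by (simp_all add: act_def)

lemma act_sum_left: "act (\<Sum>i\<in>I. f i) a = (\<Sum>i\<in>I. act (f i) a)"
  by (induction I rule: infinite_finite_induct) (simp_all add: act_add_left)

lemma act_sum_right: "act x (\<Sum>i\<in>I. f i) = (\<Sum>i\<in>I. act x (f i))"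
  by (induction I rule: infinite_finite_induct) (simp_all add: act_add_right)

lemma act_single_single:
  "act (Poly_Mapping.single T c) (Poly_Mapping.single \<sigma> d)
    = Poly_Mapping.single ((\<lambda>t. \<sigma> \<circ> t) ` T) (c * d)"
  by (simp add: act_superset[of "{T}" _ "{\<sigma>}"])

lemma scale_pm_single: "scale_pm c (Poly_Mapping.single T d) = Poly_Mapping.single T (c * d)"
  by (rule poly_mapping_eqI) (simp add: lookup_scale_pm lookup_single when_def)

lemma act_scale_left: "act (scale_pm c x) a = scale_pm c (act x a)"
proof -
  have "Poly_Mapping.keys (scale_pm c x) \<subseteq> Poly_Mapping.keys x"
    by (auto simp: in_keys_iff lookup_scale_pm)
  then show ?thesis
    by (simp add: act_superset[of "Poly_Mapping.keys x" _ "Poly_Mapping.keys a"]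
        fvs.scale_sum_right scale_pm_single lookup_scale_pm mult.assoc)
qed

lemma act_scale_right: "act x (scale_pm c a) = scale_pm c (act x a)"
proof -
  have "Poly_Mapping.keys (scale_pm c a) \<subseteq> Poly_Mapping.keys a"
    by (auto simp: in_keys_iff lookup_scale_pm)
  then show ?thesis
    by (simp add: act_superset[of "Poly_Mapping.keys x" _ "Poly_Mapping.keys a"]
        fvs.scale_sum_right scale_pm_single lookup_scale_pm mult.left_commute)
qed

lemma act_single_comp:
  "act (act x (Poly_Mapping.single \<sigma> c)) (Poly_Mapping.single \<tau> d)
    = act x (Poly_Mapping.single (\<tau> \<circ> \<sigma>) (c * d))"
  by (subst (1 2) poly_mapping_sum_single[of x])
    (simp add: act_sum_left act_single_single image_image o_assoc mult.assoc)

lemma act_ga_mult: "act x (ga_mult a b) = act (act x a) b"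
proof -
  have "act x (ga_mult a b) = (\<Sum>\<sigma>\<in>Poly_Mapping.keys a. \<Sum>\<tau>\<in>Poly_Mapping.keys b.
      act (act x (Poly_Mapping.single \<sigma> (Poly_Mapping.lookup a \<sigma>)))
        (Poly_Mapping.single \<tau> (Poly_Mapping.lookup b \<tau>)))"
    by (simp add: ga_mult_def act_sum_right act_single_comp)
  also have "\<dots> = (\<Sum>\<sigma>\<in>Poly_Mapping.keys a. 
      act (act x (Poly_Mapping.single \<sigma> (Poly_Mapping.lookup a \<sigma>))) b)"
    by (subst (3) poly_mapping_sum_single[of b]) (simp add: act_sum_right)
  also have "\<dots> = act (act x a) b"
    by (subst (3) poly_mapping_sum_single[of a]) (simp add: act_sum_right act_sum_left)
  finally show ?thesis .
qed

section \<open>Powers and polynomials of a group algebra element\<close>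

lemma act_one [simp]: "act x (Poly_Mapping.single id 1) = x"
  by (subst (1 2) poly_mapping_sum_single[of x]) (simp add: act_sum_left act_single_single)

lemma act_ga_power: "act x (ga_power a k) = ((\<lambda>y. act y a) ^^ k) x"
  by (induction k) (simp_all add: act_ga_mult)

text \<open>The bound \<open>m\<close> is free so that \<open>f\<close> and its product with a
  linear factor can be expanded over the same range of exponents.\<close>

lemma act_ga_poly_eq:
  assumes "degree f \<le> m"
  shows "act x (ga_poly f a) = (\<Sum>k\<le>m. scale_pm (coeff f k) (((\<lambda>y. act y a) ^^ k) x))"
proof -
  have "act x (ga_poly f a) = (\<Sum>k\<le>degree f. scale_pm (coeff f k) (((\<lambda>y. act y a) ^^ k) x))"
    by (simp add: ga_poly_def act_sum_right act_scale_right act_ga_power)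
  also have "\<dots> = (\<Sum>k\<le>m. scale_pm (coeff f k) (((\<lambda>y. act y a) ^^ k) x))"
    using assms by (intro sum.mono_neutral_left) (auto simp: coeff_eq_0 fvs.scale_zero_left)
  finally show ?thesis .
qed

lemma act_ga_poly_1 [simp]: "act x (ga_poly 1 a) = x"
  by (simp add: act_ga_poly_eq[of _ 0] fvs.scale_one)

text \<open>Products of linear factors are evaluated one factor at a time: multiplication by x
  shifts the coefficients, which applies \<open>a\<close> once more.\<close>

lemma act_ga_poly_linear_factor:
  "act x (ga_poly ([:- c, 1:] * f) a) = act (act x (ga_poly f a)) a - scale_pm c (act x (ga_poly f a))"
proof -
  define D where "D = (\<lambda>y. act y a)"
  define m where "m = Suc (degree f)"
  have deg: "degree ([:- c, 1:] * f) \<le> m"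
    using degree_mult_le[of "[:- c, 1:]" f] by (simp add: m_def)
  have df: "degree f \<le> m" by (simp add: m_def)
  have co: "coeff ([:- c, 1:] * f) k = (case k of 0 \<Rightarrow> 0 | Suc j \<Rightarrow> coeff f j) - c * coeff f k" for k
    by (simp add: coeff_pCons split: nat.split)
  have "act x (ga_poly ([:- c, 1:] * f) a)
      = (\<Sum>k\<le>m. scale_pm (case k of 0 \<Rightarrow> 0 | Suc j \<Rightarrow> coeff f j) ((D ^^ k) x))
        - (\<Sum>k\<le>m. scale_pm c (scale_pm (coeff f k) ((D ^^ k) x)))"
    unfolding act_ga_poly_eq[OF deg] co D_def
    by (simp add: fvs.scale_left_diff_distrib sum_subtractf)
  also have "(\<Sum>k\<le>m. scale_pm (case k of 0 \<Rightarrow> 0 | Suc j \<Rightarrow> coeff f j) ((D ^^ k) x))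
      = (\<Sum>k\<le>degree f. scale_pm (coeff f k) ((D ^^ Suc k) x))"
    unfolding m_def by (subst sum.atMost_Suc_shift) simp
  also have "\<dots> = D (act x (ga_poly f a))"
    by (simp add: act_ga_poly_eq[OF order_refl] D_def act_sum_left act_scale_left)
  also have "(\<Sum>k\<le>m. scale_pm c (scale_pm (coeff f k) ((D ^^ k) x))) = scale_pm c (act x (ga_poly f a))"
    by (simp only: act_ga_poly_eq[OF df] D_def fvs.scale_sum_right)
  finally show ?thesis by (simp add: D_def)
qed

section \<open>The Jucys-Murphy element and the smaller symmetric group\<close>

lemma act_jucys_murphy:
  "act x (jucys_murphy N) = (\<Sum>i\<in>{1..<N}. act x (Poly_Mapping.single (transpose i N) 1))"
  by (simp add: jucys_murphy_def act_sum_right)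

text \<open>Since \<open>\<sigma>\<close> fixes \<open>n + 1\<close>, conjugation by it only
  permutes the transpositions \<open>(i, n + 1)\<close>.\<close>

lemma act_jucys_murphy_commute_single:
  assumes "\<sigma> permutes {1..n}"
  shows "act (act x (Poly_Mapping.single \<sigma> c)) (jucys_murphy (n + 1))
    = act (act x (jucys_murphy (n + 1))) (Poly_Mapping.single \<sigma> c)"
proof -
  have fx: "\<sigma> (Suc n) = Suc n"
    using assms by (auto simp: permutes_def)
  have "\<sigma> y = Suc n \<longleftrightarrow> y = Suc n" for y
    using injD[OF permutes_inj[OF assms]] fx by metis
  then have comm: "\<sigma> \<circ> transpose i (Suc n) = transpose (\<sigma> i) (Suc n) \<circ> \<sigma>" for i
    using permutes_inj[OF assms] fx by (auto simp: fun_eq_iff transpose_def inj_eq)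
  have b: "bij_betw \<sigma> {1..<Suc n} {1..<Suc n}"
    using permutes_imp_bij[OF assms] by (simp add: atLeastLessThanSuc_atLeastAtMost)
  have "act (act x (jucys_murphy (n + 1))) (Poly_Mapping.single \<sigma> c)
      = (\<Sum>i\<in>{1..<Suc n}. act x (Poly_Mapping.single (\<sigma> \<circ> transpose i (Suc n)) c))"
    by (simp add: act_jucys_murphy act_sum_left act_single_comp del: sum.op_ivl_Suc)
  also have "\<dots> = (\<Sum>i\<in>{1..<Suc n}. act x (Poly_Mapping.single (transpose (\<sigma> i) (Suc n) \<circ> \<sigma>) c))"
    by (simp add: comm)
  also have "\<dots> = (\<Sum>i\<in>{1..<Suc n}. act x (Poly_Mapping.single (transpose i (Suc n) \<circ> \<sigma>) c))"
    by (rule sum.reindex_bij_betw[OF b, where g = "\<lambda>i. act x (Poly_Mapping.single (transpose i (Suc n) \<circ> \<sigma>) c)"])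
  also have "\<dots> = act (act x (Poly_Mapping.single \<sigma> c)) (jucys_murphy (n + 1))"
    by (simp add: act_jucys_murphy act_single_comp del: sum.op_ivl_Suc)
  finally show ?thesis by simp
qed

lemma act_jucys_murphy_commute:
  assumes "a \<in> sym_group_alg n"
  shows "act (act x a) (jucys_murphy (n + 1)) = act (act x (jucys_murphy (n + 1))) a"
proof -
  have "act (act x a) (jucys_murphy (n + 1)) = (\<Sum>\<sigma>\<in>Poly_Mapping.keys a.
      act (act x (Poly_Mapping.single \<sigma> (Poly_Mapping.lookup a \<sigma>))) (jucys_murphy (n + 1)))"
    by (subst poly_mapping_sum_single[of a]) (simp add: act_sum_right act_sum_left)
  also have "\<dots> = (\<Sum>\<sigma>\<in>Poly_Mapping.keys a.
      act (act x (jucys_murphy (n + 1))) (Poly_Mapping.single \<sigma> (Poly_Mapping.lookup a \<sigma>)))"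
    using assms by (intro sum.cong refl act_jucys_murphy_commute_single) (auto simp: sym_group_alg_def)
  also have "\<dots> = act (act x (jucys_murphy (n + 1))) a"
    by (subst (3) poly_mapping_sum_single[of a]) (simp add: act_sum_right)
  finally show ?thesis .
qed

lemma act_ga_poly_commute:
  assumes "a \<in> sym_group_alg n"
  shows "act (act x a) (ga_poly f (jucys_murphy (n + 1))) = act (act x (ga_poly f (jucys_murphy (n + 1)))) a"
proof -
  have "((\<lambda>y. act y (jucys_murphy (n + 1))) ^^ k) (act x a)
      = act (((\<lambda>y. act y (jucys_murphy (n + 1))) ^^ k) x) a" for k
    by (induction k) (simp_all add: act_jucys_murphy_commute[OF assms, simplified])
  then show ?thesis
    by (simp add: act_ga_poly_eq[OF order_refl] act_sum_left act_scale_left)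
qed

section \<open>Coefficients of polytabloids\<close>

text \<open>Integer values matter: a sum equal to its own negative need not vanish in characteristic
  2. Fixed points of \<open>g\<close> are harmless, because \<open>f\<close> is 0 there.\<close>

lemma sum_sign_reversing_involution:
  fixes f :: "'b \<Rightarrow> int"
  assumes "\<And>x. x \<in> A \<Longrightarrow> g x \<in> A" "\<And>x. x \<in> A \<Longrightarrow> g (g x) = x" "\<And>x. x \<in> A \<Longrightarrow> f (g x) = - f x"
  shows "sum f A = 0"
proof -
  have "sum f A = sum (\<lambda>x. - f x) A"
    by (rule sum.reindex_bij_witness[of _ g g]) (use assms in auto)
  then show ?thesis by (simp add: sum_negf)
qed

text \<open>\<open>N\<close> will be \<open>n + 1\<close>, so that \<open>jucys_murphy N\<close> is
  the element of the theorem.\<close>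

locale young_diagram =
  fixes lam :: "nat \<Rightarrow> nat" and N :: nat
  assumes part: "partition_of N lam"
begin

abbreviation D :: "node set" where "D \<equiv> diagram lam"

lemma lam_antimono: "i \<le> j \<Longrightarrow> lam j \<le> lam i"
  using part by (auto simp: partition_of_def antimono_def)

lemma in_diagram: "z \<in> D \<longleftrightarrow> snd z < lam (fst z)"
  by (cases z) (simp add: diagram_def)

lemma diagram_Sigma: "D = (SIGMA i:{i. lam i \<noteq> 0}. {..<lam i})"
  by (auto simp: diagram_def)

lemma finite_diagram [simp]: "finite D"
  unfolding diagram_Sigma using part by (intro finite_SigmaI) (auto simp: partition_of_def)

lemma card_diagram [simp]: "card D = N"
  unfolding diagram_Sigma using part by (subst card_SigmaI) (auto simp: partition_of_def)

lemma diagram_down_closed: "(i', j') \<in> D \<Longrightarrow> i \<le> i' \<Longrightarrow> j \<le> j' \<Longrightarrow> (i, j) \<in> D"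
  using lam_antimono[of i i'] by (auto simp: diagram_def)

lemma tableau_inj: "is_tableau lam t \<Longrightarrow> inj_on t D"
  and tableau_image: "is_tableau lam t \<Longrightarrow> t ` D = {1..N}"
  and tableau_outside: "is_tableau lam t \<Longrightarrow> z \<notin> D \<Longrightarrow> t z = 0"
  and tableau_bij: "is_tableau lam t \<Longrightarrow> bij_betw t D {1..N}"
  by (auto simp: is_tableau_def bij_betw_def simp del: split_paired_All)

lemma tableau_in: "is_tableau lam t \<Longrightarrow> z \<in> D \<Longrightarrow> t z \<in> {1..N}"
  using tableau_image by blast

lemma tableau_eq_iff: "is_tableau lam t \<Longrightarrow> z \<in> D \<Longrightarrow> w \<in> D \<Longrightarrow> t z = t w \<longleftrightarrow> z = w"
  using tableau_inj by (metis inj_on_eq_iff)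

lemma tableau_comp_left:
  assumes "\<sigma> permutes {1..N}" "is_tableau lam t"
  shows "is_tableau lam (\<sigma> \<circ> t)"
proof -
  have "bij_betw (\<sigma> \<circ> t) D {1..N}"
    using tableau_bij[OF assms(2)] permutes_imp_bij[OF assms(1)] by (rule bij_betw_trans)
  moreover have "\<sigma> 0 = 0" using assms(1) by (auto simp: permutes_def)
  ultimately show ?thesis using tableau_outside[OF assms(2)] by (simp add: is_tableau_def)
qed

lemma tableau_comp_right:
  assumes "\<pi> permutes D" "is_tableau lam t"
  shows "is_tableau lam (t \<circ> \<pi>)"
proof -
  have "bij_betw (t \<circ> \<pi>) D {1..N}"
    using permutes_imp_bij[OF assms(1)] tableau_bij[OF assms(2)] by (rule bij_betw_trans)
  then show ?thesis
    using tableau_outside[OF assms(2)] permutes_not_in[OF assms(1)] by (simp add: is_tableau_def)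
qed

text \<open>
  A tabloid is encoded by the function \<open>\<rho>\<close> sending each entry to its row.  If \<open>\<rho>\<close> has the wrong
  row sizes then \<open>tabloid_with \<rho>\<close> is empty; the values of \<open>\<rho>\<close> outside \<open>{1..N}\<close> are irrelevant.
\<close>

definition fits :: "tableau \<Rightarrow> (nat \<Rightarrow> nat) \<Rightarrow> bool" where
  "fits t \<rho> \<longleftrightarrow> (\<forall>z\<in>D. \<rho> (t z) = fst z)"

definition tabloid_with :: "(nat \<Rightarrow> nat) \<Rightarrow> tabloid" where
  "tabloid_with \<rho> = {s. is_tableau lam s \<and> fits s \<rho>}"

definition row_fun :: "tableau \<Rightarrow> nat \<Rightarrow> nat" where
  "row_fun t k = fst (inv_into D t k)"

definition coef :: "(tabloid \<Rightarrow>\<^sub>0 'a::field) \<Rightarrow> (nat \<Rightarrow> nat) \<Rightarrow> 'a" where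
  "coef x \<rho> = Poly_Mapping.lookup x (tabloid_with \<rho>)"

lemma coef_add: "coef (x + y) \<rho> = coef x \<rho> + coef y \<rho>"
  and coef_diff: "coef (x - y) \<rho> = coef x \<rho> - coef y \<rho>"
  and coef_scale: "coef (scale_pm c x) \<rho> = c * coef x \<rho>"
  and coef_zero [simp]: "coef 0 \<rho> = 0"
  and coef_sum: "coef (\<Sum>i\<in>I. f i) \<rho> = (\<Sum>i\<in>I. coef (f i) \<rho>)"
  by (simp_all add: coef_def lookup_add lookup_minus lookup_scale_pm lookup_sum_pm)

lemma row_fun_apply: "is_tableau lam t \<Longrightarrow> z \<in> D \<Longrightarrow> row_fun t (t z) = fst z"
  by (simp add: row_fun_def tableau_inj)

lemma fits_row_fun: "is_tableau lam t \<Longrightarrow> fits t (row_fun t)"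
  by (simp add: fits_def row_fun_apply)

lemma fits_eq_on:
  assumes "is_tableau lam t" "fits t \<rho>" "k \<in> {1..N}"
  shows "\<rho> k = row_fun t k"
proof -
  obtain z where "z \<in> D" "k = t z" using tableau_image[OF assms(1)] assms(3) by blast
  then show ?thesis using assms by (simp add: row_fun_apply fits_def)
qed

lemma fits_cong:
  assumes "is_tableau lam t" "\<And>k. k \<in> {1..N} \<Longrightarrow> \<rho> k = \<rho>' k"
  shows "fits t \<rho> \<longleftrightarrow> fits t \<rho>'"
  using assms tableau_in[OF assms(1)] by (simp add: fits_def)

lemma coef_cong:
  assumes "\<And>k. k \<in> {1..N} \<Longrightarrow> \<rho> k = \<rho>' k"
  shows "coef x \<rho> = coef x \<rho>'"
proof -
  have "tabloid_with \<rho> = tabloid_with \<rho>'"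
    using fits_cong[of _ \<rho> \<rho>'] assms by (auto simp: tabloid_with_def)
  then show ?thesis by (simp add: coef_def)
qed

lemma fits_row_image:
  assumes "is_tableau lam s" "fits s \<rho>"
  shows "s ` {x \<in> D. fst x = i} = {k \<in> {1..N}. \<rho> k = i}"
  using tableau_image[OF assms(1)] assms(2) unfolding fits_def by fastforce

lemma tabloid_of_eq:
  assumes "is_tableau lam t" "fits t \<rho>"
  shows "tabloid_of lam t = tabloid_with \<rho>"
proof (intro set_eqI iffI)
  fix s assume "s \<in> tabloid_with \<rho>"
  then show "s \<in> tabloid_of lam t"
    using fits_row_image[OF assms] fits_row_image[of s \<rho>]
    by (simp add: tabloid_with_def tabloid_of_def)
next
  fix s assume s: "s \<in> tabloid_of lam t"
  have "\<rho> (s z) = fst z" if "z \<in> D" for z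
  proof -
    have "s z \<in> s ` {x \<in> D. fst x = fst z}" using that by blast
    also have "\<dots> = t ` {x \<in> D. fst x = fst z}" using s by (simp add: tabloid_of_def)
    finally show ?thesis using assms(2) by (auto simp: fits_def)
  qed
  then show "s \<in> tabloid_with \<rho>" using s by (simp add: tabloid_of_def tabloid_with_def fits_def)
qed

lemma tabloid_of_eq_iff:
  assumes "is_tableau lam t"
  shows "tabloid_of lam t = tabloid_with \<rho> \<longleftrightarrow> fits t \<rho>"
proof
  assume "tabloid_of lam t = tabloid_with \<rho>"
  moreover have "t \<in> tabloid_of lam t" using assms by (simp add: tabloid_of_def)
  ultimately show "fits t \<rho>" by (simp add: tabloid_with_def)
qed (rule tabloid_of_eq[OF assms])

lemma image_comp_tabloid_with:
  assumes "\<sigma> permutes {1..N}"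
  shows "(\<lambda>t. \<sigma> \<circ> t) ` tabloid_with (\<rho> \<circ> \<sigma>) = tabloid_with \<rho>"
proof (intro set_eqI iffI)
  fix s assume "s \<in> (\<lambda>t. \<sigma> \<circ> t) ` tabloid_with (\<rho> \<circ> \<sigma>)"
  then show "s \<in> tabloid_with \<rho>"
    using tableau_comp_left[OF assms] by (auto simp: tabloid_with_def fits_def)
next
  fix s assume s: "s \<in> tabloid_with \<rho>"
  have "s = \<sigma> \<circ> (inv \<sigma> \<circ> s)"
    using permutes_inverses(1)[OF assms] by (simp add: fun_eq_iff)
  moreover have "inv \<sigma> \<circ> s \<in> tabloid_with (\<rho> \<circ> \<sigma>)"
    using s tableau_comp_left[OF permutes_inv[OF assms], of s] permutes_inverses(1)[OF assms]
    by (simp add: tabloid_with_def fits_def)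
  ultimately show "s \<in> (\<lambda>t. \<sigma> \<circ> t) ` tabloid_with (\<rho> \<circ> \<sigma>)" by blast
qed

lemma image_comp_tabloid_of:
  assumes "\<sigma> permutes {1..N}" "is_tableau lam t"
  shows "(\<lambda>s. \<sigma> \<circ> s) ` tabloid_of lam t = tabloid_of lam (\<sigma> \<circ> t)"
proof -
  define \<rho> where "\<rho> = row_fun t \<circ> inv \<sigma>"
  have \<rho>: "\<rho> \<circ> \<sigma> = row_fun t"
    using permutes_inverses(2)[OF assms(1)] by (simp add: \<rho>_def fun_eq_iff)
  have "fits (\<sigma> \<circ> t) \<rho>" "fits t (\<rho> \<circ> \<sigma>)"
    using fits_row_fun[OF assms(2)] \<rho> by (auto simp: fits_def fun_eq_iff)
  then show ?thesis
    using tabloid_of_eq assms(2) tableau_comp_left[OF assms] image_comp_tabloid_with[OF assms(1)]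
    by metis
qed

section \<open>Signed column sums as sums over permutations of the nodes\<close>

definition column_perms :: "(node \<Rightarrow> node) set" where
  "column_perms = {\<pi>. \<pi> permutes D \<and> (\<forall>z. snd (\<pi> z) = snd z)}"

lemma column_permsD:
  assumes "\<pi> \<in> column_perms"
  shows "\<pi> permutes D" "snd (\<pi> z) = snd z"
  using assms by (simp_all add: column_perms_def del: split_paired_All)

lemma finite_column_perms [simp]: "finite column_perms"
  using finite_permutations[OF finite_diagram] by (rule finite_subset[rotated]) (auto simp: column_perms_def)

lemma id_in_column_perms: "id \<in> column_perms"
  by (simp add: column_perms_def permutes_id)

lemma column_perms_swap:
  assumes "\<pi> \<in> column_perms" "z \<in> D" "w \<in> D" "snd z = snd w"
  shows "\<pi> \<circ> transpose z w \<in> column_perms"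
  using assms permutes_compose[OF permutes_swap_id[OF assms(2,3)], of \<pi>]
  by (auto simp: column_perms_def transpose_def simp del: split_paired_All)

lemma sign_column_perms_swap:
  assumes "\<pi> \<in> column_perms" "z \<noteq> w"
  shows "sign (\<pi> \<circ> transpose z w) = - sign \<pi>"
proof -
  have "permutation \<pi>"
    using assms(1) permutes_imp_permutation[OF finite_diagram] by (simp add: column_perms_def)
  then show ?thesis using assms(2) by (simp add: sign_compose[OF _ permutation_swap_id] sign_swap_id)
qed

text \<open>Conjugation by the bijection \<open>t\<close> between nodes and entries matches the two
  index sets and preserves signs.\<close>

lemma column_stabilizer_reindex:
  assumes t: "is_tableau lam t"
  shows "(\<Sum>\<sigma>\<in>column_stabilizer lam t. g (\<sigma> \<circ> t) (sign \<sigma>)) = (\<Sum>\<pi>\<in>column_perms. g (t \<circ> \<pi>) (sign \<pi>))"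
proof (rule sum.reindex_bij_witness[where j = "map_permutation {1..N} (inv_into D t)"
      and i = "map_permutation D t"])
  let ?t' = "inv_into D t"
  note inj = tableau_inj[OF t] and bij = tableau_bij[OF t]
  have bij': "bij_betw ?t' {1..N} D" by (rule bij_betw_inv_into[OF bij])
  have t't: "?t' (t z) = z" if "z \<in> D" for z using inj that by simp
  have tt': "t (?t' k) = k" if "k \<in> {1..N}" for k
    using that tableau_image[OF t] by (metis f_inv_into_f)
  have comp: "map_permutation D t \<pi> \<circ> t = t \<circ> \<pi>" if "\<pi> permutes D" for \<pi>
  proof
    fix z
    have p: "map_permutation D t \<pi> permutes {1..N}"
      using map_permutation_permutes[OF bij that] .
    show "(map_permutation D t \<pi> \<circ> t) z = (t \<circ> \<pi>) z"
    proof (cases "z \<in> D")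
      case True then show ?thesis by (simp add: map_permutation_apply[OF inj])
    next
      case False
      then show ?thesis using permutes_not_in[OF that] permutes_not_in[OF p, of 0]
        by (simp add: tableau_outside[OF t])
    qed
  qed
  {
    fix \<sigma> assume "\<sigma> \<in> column_stabilizer lam t"
    then have s: "\<sigma> permutes {1..N}"
      and col: "\<And>j. \<sigma> ` t ` {x \<in> D. snd x = j} = t ` {x \<in> D. snd x = j}"
      by (auto simp: column_stabilizer_def)
    let ?p = "map_permutation {1..N} ?t' \<sigma>"
    show bk: "map_permutation D t ?p = \<sigma>"
      by (rule map_permutation_compose_inv[OF bij' s]) (rule tt')
    have p: "?p permutes D" by (rule map_permutation_permutes[OF bij' s])
    have "snd (?p z) = snd z" for z
    proof (cases "z \<in> D")
      case True
      have "?p (?t' (t z)) = ?t' (\<sigma> (t z))"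
        by (rule map_permutation_apply[OF bij_betw_imp_inj_on[OF bij']]) (rule tableau_in[OF t True])
      then have 1: "?p z = ?t' (\<sigma> (t z))" using t't[OF True] by simp
      have "\<sigma> (t z) \<in> \<sigma> ` t ` {x \<in> D. snd x = snd z}" using True by blast
      then have "\<sigma> (t z) \<in> t ` {x \<in> D. snd x = snd z}" using col by simp
      then show ?thesis using t't 1 by auto
    next
      case False then show ?thesis using permutes_not_in[OF p] by simp
    qed
    then show "?p \<in> column_perms" using p by (simp add: column_perms_def)
    have "sign ?p = sign \<sigma>"
      by (rule sign_map_permutation[OF bij_betw_imp_inj_on[OF bij'] s]) simp
    then show "g (t \<circ> ?p) (sign ?p) = g (\<sigma> \<circ> t) (sign \<sigma>)"
      using comp[OF p] bk by simp
  }
  {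
    fix \<pi> assume "\<pi> \<in> column_perms"
    then have p: "\<pi> permutes D" and col: "\<And>z. snd (\<pi> z) = snd z"
      by (auto simp: column_perms_def)
    show "map_permutation {1..N} ?t' (map_permutation D t \<pi>) = \<pi>"
      by (rule map_permutation_compose_inv[OF bij p]) (rule t't)
    have "\<pi> ` {x \<in> D. snd x = j} = {x \<in> D. snd x = j}" for j
    proof -
      have "\<pi> ` {x \<in> D. snd x = j} \<subseteq> {x \<in> D. snd x = j}"
        using permutes_in_image[OF p] col by auto
      then show ?thesis
        by (intro endo_inj_surj) (auto intro: inj_on_subset[OF permutes_inj[OF p]])
    qed
    then have "map_permutation D t \<pi> ` t ` {x \<in> D. snd x = j} = t ` {x \<in> D. snd x = j}" for j
      by (metis (no_types, lifting) comp[OF p] image_comp)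
    then show "map_permutation D t \<pi> \<in> column_stabilizer lam t"
      using map_permutation_permutes[OF bij p] by (simp add: column_stabilizer_def)
  }
qed

text \<open>
  Permuting the nodes rather than the entries makes the index set of this sum independent of \<open>t\<close>.
\<close>

lemma polytabloid_eq:
  assumes "is_tableau lam t"
  shows "(polytabloid lam t :: tabloid \<Rightarrow>\<^sub>0 'a::field)
    = (\<Sum>\<pi>\<in>column_perms. Poly_Mapping.single (tabloid_of lam (t \<circ> \<pi>)) (of_int (sign \<pi>)))"
proof -
  have "(polytabloid lam t :: tabloid \<Rightarrow>\<^sub>0 'a) = (\<Sum>\<sigma>\<in>column_stabilizer lam t.
      Poly_Mapping.single (tabloid_of lam (\<sigma> \<circ> t)) (of_int (sign \<sigma>)))"
    unfolding polytabloid_def signed_column_sum_def act_sum_right act_single_single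
    using assms by (intro sum.cong) (auto simp: image_comp_tabloid_of column_stabilizer_def)
  then show ?thesis
    using column_stabilizer_reindex[OF assms,
        of "\<lambda>s e. Poly_Mapping.single (tabloid_of lam s) (of_int e :: 'a)"] by simp
qed

text \<open>The coefficients of a polytabloid over the integers, where sign-reversing cancellation
  is valid; the coefficients in the field are their images.\<close>

definition icoef :: "tableau \<Rightarrow> (nat \<Rightarrow> nat) \<Rightarrow> int" where
  "icoef t \<rho> = (\<Sum>\<pi> | \<pi> \<in> column_perms \<and> fits (t \<circ> \<pi>) \<rho>. sign \<pi>)"

lemma coef_polytabloid:
  assumes "is_tableau lam t"
  shows "coef (polytabloid lam t) \<rho> = (of_int (icoef t \<rho>) :: 'a::field)"
proof -
  have "coef (polytabloid lam t) \<rho>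
      = (\<Sum>\<pi>\<in>column_perms. if fits (t \<circ> \<pi>) \<rho> then of_int (sign \<pi>) :: 'a else 0)"
    unfolding polytabloid_eq[OF assms] coef_sum
    using tabloid_of_eq_iff[OF tableau_comp_right[OF _ assms]]
    by (intro sum.cong refl) (auto simp: coef_def lookup_single when_def column_perms_def)
  also have "\<dots> = of_int (icoef t \<rho>)"
    by (simp add: icoef_def sum.inter_filter[symmetric])
  finally show ?thesis .
qed

text \<open>The column permutations of the nodes do not depend on the tableau, so relabelling the
  entries passes through the signed sum term by term.\<close>

lemma act_polytabloid:
  assumes "\<sigma> permutes {1..N}" "is_tableau lam t"
  shows "act (polytabloid lam t) (Poly_Mapping.single \<sigma> c) = scale_pm c (polytabloid lam (\<sigma> \<circ> t))"
  unfolding polytabloid_eq[OF assms(2)] polytabloid_eq[OF tableau_comp_left[OF assms]]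
    act_sum_left act_single_single fvs.scale_sum_right scale_pm_single
  using image_comp_tabloid_of[OF assms(1) tableau_comp_right[OF _ assms(2)]]
  by (intro sum.cong) (auto simp: column_perms_def o_assoc mult.commute)

lemma inj_image_comp:
  assumes "inj \<sigma>"
  shows "(\<lambda>t. \<sigma> \<circ> t) ` A = (\<lambda>t. \<sigma> \<circ> t) ` B \<longleftrightarrow> A = B"
  using assms by (intro inj_image_eq_iff) (auto simp: inj_def fun_eq_iff)

lemma coef_act_single:
  assumes "\<sigma> permutes {1..N}"
  shows "coef (act x (Poly_Mapping.single \<sigma> c)) \<rho> = c * coef x (\<rho> \<circ> \<sigma>)"
proof -
  have "act x (Poly_Mapping.single \<sigma> c) = (\<Sum>T\<in>Poly_Mapping.keys x.
      Poly_Mapping.single ((\<lambda>t. \<sigma> \<circ> t) ` T) (Poly_Mapping.lookup x T * c))"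
    by (subst poly_mapping_sum_single[of x]) (simp add: act_sum_left act_single_single)
  then have "coef (act x (Poly_Mapping.single \<sigma> c)) \<rho> = (\<Sum>T\<in>Poly_Mapping.keys x.
      if T = tabloid_with (\<rho> \<circ> \<sigma>) then Poly_Mapping.lookup x T * c else 0)"
    using inj_image_comp[OF permutes_inj[OF assms], of _ "tabloid_with (\<rho> \<circ> \<sigma>)"]
    by (simp add: coef_def lookup_sum_pm lookup_single when_def image_comp_tabloid_with[OF assms])
  then show ?thesis by (simp add: coef_def in_keys_iff mult.commute)
qed

lemma coef_act_jucys_murphy:
  "coef (act x (jucys_murphy N)) \<rho> = (\<Sum>i\<in>{1..<N}. coef x (\<rho> \<circ> transpose i N))"
  unfolding act_jucys_murphy coef_sum
  by (intro sum.cong refl, subst coef_act_single) (auto intro!: permutes_swap_id)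

section \<open>The Specht module as a submodule, and its support\<close>

lemma subspace_specht: "fvs.subspace (specht lam)"
  by (simp add: specht_def fvs.subspace_span)

lemma polytabloid_in_specht: "is_tableau lam t \<Longrightarrow> polytabloid lam t \<in> specht lam"
  unfolding specht_def by (rule fvs.span_base) blast

lemma act_in_specht:
  assumes "x \<in> specht lam" "a \<in> sym_group_alg N"
  shows "act x a \<in> specht lam"
proof -
  have single: "act x (Poly_Mapping.single \<sigma> c) \<in> specht lam" if "\<sigma> permutes {1..N}" for \<sigma> c
    using assms(1) unfolding specht_def
  proof (induction rule: fvs.span_induct_alt)
    case base then show ?case by (simp add: fvs.span_zero)
  next
    case (step d y z)
    then obtain t where "y = polytabloid lam t" "is_tableau lam t" by blast
    then show ?case
      using step act_polytabloid[OF that, of t c] polytabloid_in_specht[OF tableau_comp_left[OF that, of t]]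
      by (auto simp: act_add_left act_scale_left specht_def simp del: fvs.scale_scale
          intro!: fvs.span_add fvs.span_scale)
  qed
  show ?thesis
    using assms(2) single
    by (subst poly_mapping_sum_single[of a], subst act_sum_right)
      (auto simp: sym_group_alg_def intro!: fvs.subspace_sum[OF subspace_specht])
qed

lemma jucys_murphy_in_sym_group_alg: "(jucys_murphy N :: 'a::field group_alg) \<in> sym_group_alg N"
proof -
  have "\<sigma> permutes {1..N}" if key: "\<sigma> \<in> Poly_Mapping.keys (jucys_murphy N :: 'a group_alg)" for \<sigma>
  proof -
    obtain i where "i \<in> {1..<N}" "\<sigma> \<in> Poly_Mapping.keys (Poly_Mapping.single (transpose i N) (1::'a))"
      using key Poly_Mapping.keys_sum[of "\<lambda>i. Poly_Mapping.single (transpose i N) (1::'a)" "{1..<N}"]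
      unfolding jucys_murphy_def by blast
    then show ?thesis by (auto split: if_splits intro: permutes_swap_id)
  qed
  then show ?thesis by (simp add: sym_group_alg_def)
qed

text \<open>Elements of type \<open>tabloid\<close> are arbitrary sets of tableaux. Members of the
  Specht module are supported on genuine tabloids, so \<open>coef\<close> captures them completely,
  and row functions with wrong row sizes have coefficient 0.\<close>

lemma specht_keys:
  assumes "x \<in> specht lam" "T \<in> Poly_Mapping.keys x"
  obtains \<rho> t where "T = tabloid_with \<rho>" "is_tableau lam t" "fits t \<rho>"
proof -
  let ?K = "{tabloid_of lam t |t. is_tableau lam t}"
  have "Poly_Mapping.keys x \<subseteq> ?K"
    using assms(1) unfolding specht_def
  proof (induction rule: fvs.span_induct_alt)
    case base then show ?case by simp
  next
    case (step c y z)
    then obtain t where t: "y = polytabloid lam t" "is_tableau lam t" by blast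
    have "Poly_Mapping.keys y \<subseteq> (\<Union>\<pi>\<in>column_perms. Poly_Mapping.keys
        (Poly_Mapping.single (tabloid_of lam (t \<circ> \<pi>)) (of_int (sign \<pi>) :: 'a)))"
      unfolding t polytabloid_eq[OF t(2)] by (rule Poly_Mapping.keys_sum)
    also have "\<dots> \<subseteq> ?K"
      using tableau_comp_right[OF _ t(2)] by (auto simp: column_perms_def split: if_splits)
    finally have "Poly_Mapping.keys (scale_pm c y) \<subseteq> ?K"
      by (auto simp: in_keys_iff lookup_scale_pm)
    then show ?case using step Poly_Mapping.keys_add[of "scale_pm c y" z] by blast
  qed
  then obtain t where "T = tabloid_of lam t" "is_tableau lam t" using assms(2) by blast
  then show ?thesis using that[of "row_fun t" t] tabloid_of_eq[of t] fits_row_fun by simp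
qed

lemma specht_eq_zero:
  assumes "x \<in> specht lam" "\<And>\<rho>. coef x \<rho> = 0"
  shows "x = 0"
proof (rule ccontr)
  assume "x \<noteq> 0"
  then obtain T where "T \<in> Poly_Mapping.keys x" by (metis all_not_in_conv keys_eq_empty)
  with specht_keys[OF assms(1)] obtain \<rho> where "T = tabloid_with \<rho>" by blast
  then show False using assms(2)[of \<rho>] \<open>T \<in> _\<close> by (simp add: coef_def in_keys_iff)
qed

lemma specht_coef_fits:
  assumes "x \<in> specht lam" "coef x \<rho> \<noteq> 0"
  obtains t where "is_tableau lam t" "fits t \<rho>"
proof -
  have "tabloid_with \<rho> \<in> Poly_Mapping.keys x" using assms(2) by (simp add: coef_def in_keys_iff)
  then obtain \<rho>' t where "tabloid_with \<rho> = tabloid_with \<rho>'" "is_tableau lam t" "fits t \<rho>'"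
    using specht_keys[OF assms(1)] by blast
  then show ?thesis using that[of t] by (auto simp: tabloid_with_def)
qed

section \<open>Garnir relations and the standard basis theorem\<close>

lemma icoef_nonzero:
  assumes "icoef t \<rho> \<noteq> 0"
  obtains \<pi> where "\<pi> \<in> column_perms" "fits (t \<circ> \<pi>) \<rho>"
  using assms by (metis (mono_tags, lifting) Collect_empty_eq icoef_def sum.empty)

lemma fits_unique:
  assumes "is_tableau lam t" "fits t \<rho>" "fits t \<rho>'" "\<And>k. k \<notin> {1..N} \<Longrightarrow> \<rho> k = \<rho>' k"
  shows "\<rho> = \<rho>'"
  using fits_eq_on[OF assms(1,2)] fits_eq_on[OF assms(1,3)] assms(4) by (metis ext)

text \<open>
  The Garnir relation for the rows \<open>i\<close> and \<open>i + 1\<close>, written as a linear functional that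
  vanishes on polytabloids: a column whose entries in both rows lie in \<open>Y\<close> exists because
  \<open>Y\<close> has more than \<open>lam i\<close> elements, and swapping them in the leftmost such column reverses signs.
\<close>

definition garnir_set :: "nat \<Rightarrow> nat set \<Rightarrow> (nat \<Rightarrow> nat) \<Rightarrow> (nat \<Rightarrow> nat) set" where
  "garnir_set i Y \<rho> = {\<rho>'. (\<forall>k. k \<notin> Y \<longrightarrow> \<rho>' k = \<rho> k) \<and> (\<forall>k\<in>Y. \<rho>' k \<in> {i, Suc i})}"

lemma finite_garnir_set:
  assumes "finite Y"
  shows "finite (garnir_set i Y \<rho>)"
proof -
  let ?g = "\<lambda>B k. if k \<in> Y then if k \<in> B then i else Suc i else \<rho> k"
  have "\<rho>' \<in> ?g ` Pow Y" if "\<rho>' \<in> garnir_set i Y \<rho>" for \<rho>'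
    using that by (intro image_eqI[of _ _ "{k \<in> Y. \<rho>' k = i}"]) (auto simp: garnir_set_def fun_eq_iff)
  then show ?thesis using assms by (intro finite_surj[of "Pow Y" _ ?g]) auto
qed

lemma sum_icoef_garnir_set:
  assumes t: "is_tableau lam t" and Y: "Y \<subseteq> {1..N}" "card Y > lam i"
  shows "(\<Sum>\<rho>'\<in>garnir_set i Y \<rho>. icoef t \<rho>') = 0"
proof -
  have finY: "finite Y" using Y(1) finite_subset by blast
  define P where "P \<pi> \<longleftrightarrow> (\<exists>\<rho>'\<in>garnir_set i Y \<rho>. fits (t \<circ> \<pi>) \<rho>')" for \<pi>
  define good where "good \<pi> j \<longleftrightarrow> (Suc i, j) \<in> D \<and> t (\<pi> (i, j)) \<in> Y \<and> t (\<pi> (Suc i, j)) \<in> Y" for \<pi> j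
  define g where "g \<pi> = (let j = LEAST j. good \<pi> j in \<pi> \<circ> transpose (i, j) (Suc i, j))" for \<pi>
  have up: "(i, j) \<in> D" if "(Suc i, j) \<in> D" for j
    using diagram_down_closed[OF that, of i j] by simp
  have tab: "is_tableau lam (t \<circ> \<pi>)" if "\<pi> \<in> column_perms" for \<pi>
    using that tableau_comp_right[OF _ t] by (simp add: column_perms_def)
  have "(\<Sum>\<rho>'\<in>garnir_set i Y \<rho>. icoef t \<rho>')
      = (\<Sum>\<rho>'\<in>garnir_set i Y \<rho>. \<Sum>\<pi>\<in>column_perms. if fits (t \<circ> \<pi>) \<rho>' then sign \<pi> else 0)"
    by (simp add: icoef_def sum.inter_filter[symmetric])
  also have "\<dots> = (\<Sum>\<pi>\<in>column_perms. \<Sum>\<rho>'\<in>garnir_set i Y \<rho>. if fits (t \<circ> \<pi>) \<rho>' then sign \<pi> else 0)"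
    by (rule sum.swap)
  also have "\<dots> = (\<Sum>\<pi>\<in>column_perms. if P \<pi> then sign \<pi> else 0)"
  proof (intro sum.cong refl)
    fix \<pi> assume pi: "\<pi> \<in> column_perms"
    show "(\<Sum>\<rho>'\<in>garnir_set i Y \<rho>. if fits (t \<circ> \<pi>) \<rho>' then sign \<pi> else 0) = (if P \<pi> then sign \<pi> else 0)"
    proof (cases "P \<pi>")
      case True
      then obtain \<rho>1 where r1: "\<rho>1 \<in> garnir_set i Y \<rho>" "fits (t \<circ> \<pi>) \<rho>1" by (auto simp: P_def)
      \<comment> \<open>A fixed tableau fits at most one member of the Garnir set: the tableau
        determines the values on \<open>{1..N}\<close>, and elsewhere all members agree.\<close>
      have "fits (t \<circ> \<pi>) \<rho>' \<longleftrightarrow> \<rho>' = \<rho>1" if "\<rho>' \<in> garnir_set i Y \<rho>" for \<rho>'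
      proof -
        have "\<rho>' k = \<rho>1 k" if k: "k \<notin> {1..N}" for k
        proof -
          have "k \<notin> Y" using k Y(1) by blast
          then show ?thesis using \<open>\<rho>' \<in> _\<close> r1(1) by (simp add: garnir_set_def)
        qed
        then show ?thesis using fits_unique[OF tab[OF pi] _ r1(2), of \<rho>'] r1(2) by blast
      qed
      then have "(\<Sum>\<rho>'\<in>garnir_set i Y \<rho>. if fits (t \<circ> \<pi>) \<rho>' then sign \<pi> else 0)
          = (\<Sum>\<rho>'\<in>garnir_set i Y \<rho>. if \<rho>' = \<rho>1 then sign \<pi> else 0)"
        by (intro sum.cong) auto
      then show ?thesis using True r1(1) finite_garnir_set[OF finY] by simp
    next
      case False
      then show ?thesis by (auto simp: P_def intro!: sum.neutral)
    qed
  qed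
  also have "\<dots> = (\<Sum>\<pi> | \<pi> \<in> column_perms \<and> P \<pi>. sign \<pi>)"
    by (simp add: sum.inter_filter[symmetric])
  also have "\<dots> = 0"
  proof (rule sum_sign_reversing_involution[where g = g])
    fix \<pi> assume "\<pi> \<in> {\<pi> \<in> column_perms. P \<pi>}"
    then have pi: "\<pi> \<in> column_perms" and "P \<pi>" by auto
    then obtain \<rho>1 where r1: "\<rho>1 \<in> garnir_set i Y \<rho>" "fits (t \<circ> \<pi>) \<rho>1" by (auto simp: P_def)
    have perm: "\<pi> permutes D" using pi by (simp add: column_perms_def)
    define X where "X = t \<circ> \<pi>"
    have X: "is_tableau lam X" using tab[OF pi] by (simp add: X_def)
    define Z where "Z = {z \<in> D. X z \<in> Y}"
    have XZ: "X ` Z = Y"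
      using tableau_image[OF X] Y(1) by (auto simp: Z_def)
    have Zrow: "fst z \<in> {i, Suc i}" if "z \<in> Z" for z
      using that r1 by (force simp: Z_def X_def fits_def garnir_set_def)
    \<comment> \<open>Without such a column, the nodes with entries in \<open>Y\<close> would lie in
      distinct columns among the first \<open>lam i\<close>, against the size of
      \<open>Y\<close>.\<close>
    have "\<exists>j. good \<pi> j"
    proof (rule ccontr)
      assume no: "\<not> (\<exists>j. good \<pi> j)"
      have "inj_on snd Z"
      proof (rule inj_onI)
        fix z w assume zw: "z \<in> Z" "w \<in> Z" "snd z = snd w"
        have "fst z = fst w"
        proof (rule ccontr)
          assume "fst z \<noteq> fst w"
          then have "(i, snd z) \<in> Z \<and> (Suc i, snd z) \<in> Z"
            using Zrow[OF zw(1)] Zrow[OF zw(2)] zw by (cases z; cases w) auto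
          then have "good \<pi> (snd z)" by (simp add: good_def Z_def X_def)
          then show False using no by blast
        qed
        then show "z = w" using zw by (simp add: prod_eq_iff)
      qed
      then have "card Z = card (snd ` Z)" by (simp add: card_image)
      also have "snd ` Z \<subseteq> {..<lam i}"
        using Zrow lam_antimono[of i "Suc i"] by (fastforce simp: Z_def in_diagram)
      then have "card (snd ` Z) \<le> lam i" using card_mono[of "{..<lam i}" "snd ` Z"] by simp
      finally have "card Z \<le> lam i" .
      moreover have "card Y \<le> card Z"
        using card_image_le[of Z X] XZ by (simp add: Z_def)
      ultimately show False using Y(2) by simp
    qed
    then have gj: "good \<pi> (LEAST j. good \<pi> j)" by (rule LeastI_ex)
    define j where "j = (LEAST j. good \<pi> j)"
    have good: "good \<pi> j" using gj by (simp add: j_def)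
    have g: "g \<pi> = \<pi> \<circ> transpose (i, j) (Suc i, j)" by (simp add: g_def j_def Let_def)
    have inD: "(i, j) \<in> D" "(Suc i, j) \<in> D" using good up by (auto simp: good_def)
    \<comment> \<open>The swap does not change which columns are good, so the same leftmost one is
      chosen again and \<open>g\<close> is an involution.\<close>
    have "good (g \<pi>) j' \<longleftrightarrow> good \<pi> j'" for j'
      using good by (cases "j' = j") (auto simp: good_def g transpose_def)
    then have "good (g \<pi>) = good \<pi>" by blast
    then have "g (g \<pi>) = g \<pi> \<circ> transpose (i, j) (Suc i, j)"
      unfolding g_def[of "g \<pi>"] j_def Let_def by (rule ssubst) (rule refl)
    then show "g (g \<pi>) = \<pi>" by (simp add: g o_assoc[symmetric])
    show "sign (g \<pi>) = - sign \<pi>" unfolding g by (rule sign_column_perms_swap[OF pi]) simp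
    define \<rho>2 where "\<rho>2 = \<rho>1 \<circ> transpose (X (i, j)) (X (Suc i, j))"
    have inY: "X (i, j) \<in> Y" "X (Suc i, j) \<in> Y" using good by (auto simp: good_def X_def)
    have "\<rho>2 \<in> garnir_set i Y \<rho>"
      using r1(1) inY by (auto simp: garnir_set_def \<rho>2_def transpose_def)
    moreover have "fits (t \<circ> g \<pi>) \<rho>2"
      unfolding fits_def
    proof
      fix z assume z: "z \<in> D"
      have "X (transpose (i, j) (Suc i, j) z) = transpose (X (i, j)) (X (Suc i, j)) (X z)"
        using tableau_eq_iff[OF X z inD(1)] tableau_eq_iff[OF X z inD(2)] by (auto simp: transpose_def)
      then have "\<rho>2 ((t \<circ> g \<pi>) z) = \<rho>1 (X z)" by (simp add: \<rho>2_def g X_def)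
      also have "\<dots> = fst z" using r1(2) z by (simp add: fits_def X_def)
      finally show "\<rho>2 ((t \<circ> g \<pi>) z) = fst z" .
    qed
    ultimately have "P (g \<pi>)" by (auto simp: P_def)
    moreover have "g \<pi> \<in> column_perms" unfolding g by (rule column_perms_swap[OF pi inD]) simp
    ultimately show "g \<pi> \<in> {\<pi> \<in> column_perms. P \<pi>}" by simp
  qed
  finally show ?thesis .
qed

lemma sum_coef_garnir_set:
  assumes "x \<in> specht lam" and Y: "Y \<subseteq> {1..N}" "card Y > lam i"
  shows "(\<Sum>\<rho>'\<in>garnir_set i Y \<rho>. coef x \<rho>') = 0"
  using assms(1) unfolding specht_def
proof (induction rule: fvs.span_induct_alt)
  case base then show ?case by simp
next
  case (step c y z)
  then obtain t where t: "y = polytabloid lam t" "is_tableau lam t" by blast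
  have "(\<Sum>\<rho>'\<in>garnir_set i Y \<rho>. coef y \<rho>') = 0"
    using sum_icoef_garnir_set[OF t(2) Y, of \<rho>]
    by (simp add: t coef_polytabloid flip: of_int_sum)
  then show ?case using step
    by (simp add: coef_add coef_scale sum.distrib flip: sum_distrib_left)
qed

text \<open>Row functions are ordered by the row of the largest entry on which they differ.\<close>

definition weight :: "(nat \<Rightarrow> nat) \<Rightarrow> nat" where
  "weight \<rho> = (\<Sum>k\<in>{1..N}. \<rho> k * Suc (Max (fst ` D)) ^ k)"

text \<open>The digits below position \<open>a\<close> cannot outweigh one unit at position
  \<open>a\<close>; this makes comparison of weights lexicographic, starting from the largest
  entry.\<close>

lemma base_expansion_less:
  fixes f :: "nat \<Rightarrow> nat"
  assumes "\<And>k. k \<in> {1..<a} \<Longrightarrow> f k < B" "B > 0"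
  shows "(\<Sum>k\<in>{1..<a}. f k * B ^ k) < B ^ a"
  using assms
proof (induction a)
  case (Suc a)
  show ?case
  proof (cases "a = 0")
    case False
    then have "f a < B" "(\<Sum>k\<in>{1..<a}. f k * B ^ k) < B ^ a" using Suc by auto
    then have "(\<Sum>k\<in>{1..<a}. f k * B ^ k) + f a * B ^ a < B ^ a + f a * B ^ a" by simp
    also have "\<dots> = Suc (f a) * B ^ a" by simp
    also have "\<dots> \<le> B * B ^ a" using \<open>f a < B\<close> by (intro mult_right_mono) auto
    finally show ?thesis using False by simp
  qed (use Suc.prems in auto)
qed auto

lemma weight_less:
  assumes "a \<in> {1..N}" "\<rho>' a < \<rho> a" "\<And>k. k \<in> {1..N} \<Longrightarrow> k > a \<Longrightarrow> \<rho>' k = \<rho> k"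
    and bound: "\<And>k. k \<in> {1..N} \<Longrightarrow> \<rho>' k \<le> Max (fst ` D)"
  shows "weight \<rho>' < weight \<rho>"
proof -
  define B where "B = Suc (Max (fst ` D))"
  have "{1..N} = {1..<a} \<union> ({a} \<union> {a<..N})" using assms(1) by auto
  then have split: "(\<Sum>k\<in>{1..N}. f k) = (\<Sum>k\<in>{1..<a}. f k) + (f a + (\<Sum>k\<in>{a<..N}. f k))" for f :: "nat \<Rightarrow> nat"
    by (simp only:) (subst sum.union_disjoint; auto)
  have "(\<Sum>k\<in>{1..<a}. \<rho>' k * B ^ k) < B ^ a"
    using bound assms(1) by (intro base_expansion_less) (auto simp: B_def le_imp_less_Suc)
  moreover have "Suc (\<rho>' a) * B ^ a \<le> \<rho> a * B ^ a" using assms(2) by (intro mult_right_mono) auto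
  moreover have "(\<Sum>k\<in>{a<..N}. \<rho>' k * B ^ k) = (\<Sum>k\<in>{a<..N}. \<rho> k * B ^ k)"
    using assms(1,3) by (intro sum.cong) auto
  ultimately show ?thesis unfolding weight_def split B_def[symmetric] by simp
qed

lemma fits_bound:
  assumes "is_tableau lam t" "fits t \<rho>" "k \<in> {1..N}"
  shows "\<rho> k \<le> Max (fst ` D)"
proof -
  obtain z where "z \<in> D" "k = t z" using tableau_image[OF assms(1)] assms(3) by blast
  then show ?thesis using assms(2) by (auto simp: fits_def intro!: Max_ge)
qed

lemma largest_difference:
  assumes "\<exists>k\<in>{1..N}. \<rho> k \<noteq> \<rho>' (k::nat)"
  obtains a where "a \<in> {1..N}" "\<rho> a \<noteq> \<rho>' a" "\<And>k. k \<in> {1..N} \<Longrightarrow> k > a \<Longrightarrow> \<rho> k = \<rho>' k"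
proof -
  let ?S = "{k \<in> {1..N}. \<rho> k \<noteq> \<rho>' k}"
  have S: "finite ?S" "?S \<noteq> {}" using assms by auto
  show ?thesis
  proof (rule that[of "Max ?S"])
    show "\<rho> k = \<rho>' k" if "k \<in> {1..N}" "k > Max ?S" for k
    proof (rule ccontr)
      assume "\<rho> k \<noteq> \<rho>' k"
      then have "k \<in> ?S" using that by blast
      then have "k \<le> Max ?S" by (rule Max_ge[OF S(1)])
      then show False using that(2) by linarith
    qed
  qed (use Max_in[OF S] in auto)
qed

lemma weight_inj:
  assumes "is_tableau lam t" "fits t \<rho>" "is_tableau lam t'" "fits t' \<rho>'"
    and "weight \<rho> = weight \<rho>'" "k \<in> {1..N}"
  shows "\<rho> k = \<rho>' k"
proof (rule ccontr)
  assume "\<rho> k \<noteq> \<rho>' k"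
  then obtain a where a: "a \<in> {1..N}" "\<rho> a \<noteq> \<rho>' a" "\<And>k. k \<in> {1..N} \<Longrightarrow> k > a \<Longrightarrow> \<rho> k = \<rho>' k"
    using largest_difference[of \<rho> \<rho>'] assms(6) by blast
  then have "weight \<rho> \<noteq> weight \<rho>'"
    using weight_less[of a \<rho> \<rho>', OF a(1)] weight_less[of a \<rho>' \<rho>, OF a(1)]
      fits_bound[OF assms(1,2)] fits_bound[OF assms(3,4)]
    by (metis linorder_neqE_nat nat_less_le)
  then show False using assms(5) by simp
qed

section \<open>Leading tabloids of polytabloids\<close>

definition column_increasing :: "tableau \<Rightarrow> bool" where
  "column_increasing t \<longleftrightarrow> (\<forall>i i' j. i < i' \<and> (i', j) \<in> D \<longrightarrow> t (i, j) < t (i', j))"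

text \<open>Let \<open>a\<close> be the largest entry whose row changes, and suppose that it moves
  down to a node \<open>w\<close> of its column. The entry \<open>t w\<close> exceeds
  \<open>a\<close> since columns increase, so it keeps its row; being confined to its column, it
  still occupies \<open>w\<close>, a contradiction. Hence \<open>a\<close> moves up.\<close>

lemma icoef_column_increasing_less:
  assumes t: "is_tableau lam t" "column_increasing t" and "icoef t \<rho>' \<noteq> 0" "fits t \<rho>"
    and "k \<in> {1..N}" "\<rho>' k \<noteq> \<rho> k"
  shows "weight \<rho>' < weight \<rho>"
proof -
  obtain \<pi> where pi: "\<pi> \<in> column_perms" "fits (t \<circ> \<pi>) \<rho>'" using icoef_nonzero[OF assms(3)] .
  note perm = column_permsD(1)[OF pi(1)] and col = column_permsD(2)[OF pi(1)]
  obtain a where a: "a \<in> {1..N}" "\<rho>' a \<noteq> \<rho> a" and eq: "\<And>k. k \<in> {1..N} \<Longrightarrow> k > a \<Longrightarrow> \<rho>' k = \<rho> k"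
    using largest_difference[of \<rho>' \<rho>] assms(5,6) by blast
  obtain w where w: "w \<in> D" "a = t (\<pi> w)"
    using a(1) tableau_image[OF tableau_comp_right[OF perm t(1)]] by (metis comp_apply imageE)
  have pw: "\<pi> w \<in> D" using w permutes_in_image[OF perm] by blast
  have ra: "\<rho>' a = fst w" "\<rho> a = fst (\<pi> w)"
    using pi(2) assms(4) w pw by (auto simp: fits_def)
  have "\<not> fst w > fst (\<pi> w)"
  proof
    assume less: "fst w > fst (\<pi> w)"
    have "t (fst (\<pi> w), snd w) < t (fst w, snd w)"
      using t(2)[unfolded column_increasing_def, rule_format, of "fst (\<pi> w)" "fst w" "snd w"] less w(1)
      by simp
    then have gt: "a < t w" using w(2) col[of w] by (metis prod.collapse)
    obtain w' where w': "w' \<in> D" "\<pi> w' = w" 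
      using w(1) permutes_image[OF perm] by (metis imageE)
    have "fst w' = \<rho>' (t w)" using pi(2) w' by (auto simp: fits_def)
    also have "\<dots> = \<rho> (t w)" using eq gt tableau_in[OF t(1) w(1)] by blast
    also have "\<dots> = fst w" using assms(4) w(1) by (simp add: fits_def)
    finally have "w' = w" using col[of w'] w' by (simp add: prod_eq_iff)
    then show False using w' less by simp
  qed
  then have "\<rho>' a < \<rho> a" using ra a(2) by simp
  then show ?thesis
    using weight_less[OF a(1), of \<rho>' \<rho>] eq fits_bound[OF tableau_comp_right[OF perm t(1)] pi(2)] by blast
qed

text \<open>A column permutation of the nodes that also preserves rows is the identity.\<close>

lemma icoef_self:
  assumes t: "is_tableau lam t" and "fits t \<rho>"
  shows "icoef t \<rho> = 1"
proof -
  have "\<pi> = id" if "\<pi> \<in> column_perms" "fits (t \<circ> \<pi>) \<rho>" for \<pi>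
  proof
    fix z
    note perm = column_permsD(1)[OF that(1)] and col = column_permsD(2)[OF that(1)]
    show "\<pi> z = id z"
    proof (cases "z \<in> D")
      case True
      then have "\<rho> (t (\<pi> z)) = fst z" "\<rho> (t (\<pi> z)) = fst (\<pi> z)"
        using that(2) assms(2) permutes_in_image[OF perm] by (auto simp: fits_def)
      then show ?thesis using col by (simp add: prod_eq_iff)
    qed (use permutes_not_in[OF perm] in simp)
  qed
  then have "{\<pi>. \<pi> \<in> column_perms \<and> fits (t \<circ> \<pi>) \<rho>} = {id}"
    using id_in_column_perms assms(2) by auto
  then show ?thesis by (simp add: icoef_def)
qed

lemma card_row:
  assumes "is_tableau lam t" "fits t \<rho>"
  shows "card {k \<in> {1..N}. \<rho> k = i} = lam i"
proof -
  have "{x \<in> D. fst x = i} = Pair i ` {..<lam i}" by (auto simp: diagram_def)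
  then have "card {x \<in> D. fst x = i} = lam i" by (simp add: card_image inj_on_def)
  then show ?thesis
    unfolding fits_row_image[OF assms, symmetric]
    by (subst card_image) (auto intro: inj_on_subset[OF tableau_inj[OF assms(1)]])
qed

text \<open>Each row of the tabloid is sorted; the tableau \<open>t\<close> guarantees that the rows
  have the lengths prescribed by \<open>lam\<close>.\<close>

lemma row_increasing_tableau:
  assumes "is_tableau lam t" "fits t \<rho>"
  obtains s where "is_tableau lam s" "fits s \<rho>"
    "\<And>i j j'. j < j' \<Longrightarrow> (i, j') \<in> D \<Longrightarrow> s (i, j) < s (i, j')"
proof -
  define R where "R i = {k \<in> {1..N}. \<rho> k = i}" for i
  define s where "s z = (if z \<in> D then sorted_list_of_set (R (fst z)) ! snd z else 0)" for z
  have fR: "finite (R i)" and len: "length (sorted_list_of_set (R i)) = lam i" for i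
    using card_row[OF assms, of i] by (auto simp: R_def)
  have inR: "s (i, j) \<in> R i" if "(i, j) \<in> D" for i j
    using that nth_mem[of j "sorted_list_of_set (R i)"] len[of i] fR[of i]
    by (simp add: s_def diagram_def)
  have fit: "fits s \<rho>" using inR by (force simp: fits_def R_def)
  have incr: "s (i, j) < s (i, j')" if "j < j'" "(i, j') \<in> D" for i j j'
    using that len[of i] strict_sorted_list_of_set[of "R i"]
    by (auto simp: s_def diagram_def sorted_wrt_iff_nth_less)
  have "inj_on s D"
  proof (rule inj_onI)
    fix z w assume zw: "z \<in> D" "w \<in> D" "s z = s w"
    then have "fst z = fst w" using fit by (metis fits_def)
    then obtain i j j' where ij: "z = (i, j)" "w = (i, j')" by (metis prod.collapse)
    then show "z = w" using zw incr[of j j' i] incr[of j' j i]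
      by (cases j j' rule: linorder_cases) auto
  qed
  moreover have "s ` D = {1..N}"
  proof (rule card_subset_eq)
    show "s ` D \<subseteq> {1..N}" using inR by (fastforce simp: R_def)
    show "card (s ` D) = card {1..N}" using calculation by (simp add: card_image)
  qed simp
  ultimately have "is_tableau lam s" by (simp add: is_tableau_def bij_betw_def s_def)
  then show ?thesis using that fit incr by blast
qed

lemma column_increasing_if_adjacent:
  assumes "\<And>i j. (Suc i, j) \<in> D \<Longrightarrow> t (i, j) < t (Suc i, j)"
  shows "column_increasing t"
proof -
  have "t (i, j) < t (i', j)" if "i < i'" "(i', j) \<in> D" for i i' j
    using that
  proof (induction i' arbitrary: i)
    case (Suc i')
    have "(i', j) \<in> D" using diagram_down_closed[OF Suc.prems(2), of i' j] by simp
    then show ?case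
      using Suc.IH[of i] assms[OF Suc.prems(2)] Suc.prems(1) by (cases "i = i'") auto
  qed simp
  then show ?thesis by (simp add: column_increasing_def)
qed

text \<open>
  If two vertically adjacent entries of \<open>s\<close> decrease, then in the Garnir relation for the right end of
  the upper row and the left end of the lower row every other row function has larger weight.
\<close>

lemma coef_maximal_column_increasing:
  assumes x: "x \<in> specht lam" and nz: "coef x \<rho> \<noteq> 0"
    and max: "\<And>\<rho>'. coef x \<rho>' \<noteq> 0 \<Longrightarrow> weight \<rho>' \<le> weight \<rho>"
    and s: "is_tableau lam s" "fits s \<rho>"
    and incr: "\<And>i j j'. j < j' \<Longrightarrow> (i, j') \<in> D \<Longrightarrow> s (i, j) < s (i, j')"
  shows "column_increasing s"
proof (rule column_increasing_if_adjacent, rule ccontr)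
  fix i j assume ij: "(Suc i, j) \<in> D" and nless: "\<not> s (i, j) < s (Suc i, j)"
  have ij': "(i, j) \<in> D" using diagram_down_closed[OF ij, of i j] by simp
  have gt: "s (Suc i, j) < s (i, j)" using nless tableau_eq_iff[OF s(1) ij' ij] by simp
  \<comment> \<open>These sets have \<open>lam i - j\<close> and \<open>j + 1\<close> elements,
    together one more than the length of row \<open>i\<close>, as the Garnir relation
    demands.\<close>
  define U where "U = (\<lambda>c. s (i, c)) ` {j..<lam i}"
  define V where "V = (\<lambda>c. s (Suc i, c)) ` {..j}"
  have inV: "(Suc i, c) \<in> D" if "c \<le> j" for c using diagram_down_closed[OF ij, of "Suc i" c] that by simp
  have inU: "(i, c) \<in> D" if "c < lam i" for c using that by (simp add: diagram_def)
  have UN: "U \<subseteq> {1..N}" and VN: "V \<subseteq> {1..N}"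
    unfolding U_def V_def by (intro image_subsetI tableau_in[OF s(1)] inU inV, simp)+
  have fit: "\<rho> (s z) = fst z" if "z \<in> D" for z using s(2) that by (simp add: fits_def)
  have rU: "\<rho> k = i" if kU: "k \<in> U" for k
  proof -
    obtain c where "k = s (i, c)" "c < lam i" using kU by (auto simp: U_def)
    then show ?thesis using fit[OF inU] by simp
  qed
  have rV: "\<rho> k = Suc i" if kV: "k \<in> V" for k
  proof -
    obtain c where "k = s (Suc i, c)" "c \<le> j" using kV by (auto simp: V_def)
    then show ?thesis using fit[OF inV] by simp
  qed
  have disj: "U \<inter> V = {}"
  proof (rule ccontr)
    assume "U \<inter> V \<noteq> {}"
    then obtain k where "k \<in> U" "k \<in> V" by blast
    then show False using rU[of k] rV[of k] by simp
  qed
  have "inj_on (\<lambda>c. s (i, c)) {j..<lam i}"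
  proof (rule inj_onI)
    fix c d assume "c \<in> {j..<lam i}" "d \<in> {j..<lam i}" "s (i, c) = s (i, d)"
    then show "c = d" using tableau_eq_iff[OF s(1) inU inU, of c d] by simp
  qed
  then have "card U = lam i - j" by (simp add: U_def card_image)
  moreover have "inj_on (\<lambda>c. s (Suc i, c)) {..j}"
  proof (rule inj_onI)
    fix c d assume "c \<in> {..j}" "d \<in> {..j}" "s (Suc i, c) = s (Suc i, d)"
    then show "c = d" using tableau_eq_iff[OF s(1) inV inV, of c d] by simp
  qed
  then have "card V = Suc j" by (simp add: V_def card_image)
  moreover have "j < lam i" using ij' by (simp add: diagram_def)
  ultimately have card: "card (U \<union> V) > lam i"
    using disj by (subst card_Un_disjoint) (simp_all add: U_def V_def)
  \<comment> \<open>Rows increase, so the descent in column \<open>j\<close> puts all of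
    \<open>V\<close> below all of \<open>U\<close> in size.\<close>
  have less: "v < w" if vw: "v \<in> V" "w \<in> U" for v w
  proof -
    obtain c d where cd: "v = s (Suc i, c)" "c \<le> j" "w = s (i, d)" "j \<le> d" "d < lam i"
      using vw by (auto simp: U_def V_def)
    have "v \<le> s (Suc i, j)" using cd incr[of c j "Suc i"] ij by (cases "c = j") auto
    moreover have "s (i, j) \<le> w" using cd incr[of j d i] inU by (cases "d = j") auto
    ultimately show ?thesis using gt by simp
  qed
  have zero: "coef x \<rho>' = 0" if g: "\<rho>' \<in> garnir_set i (U \<union> V) \<rho>" and ne: "\<rho>' \<noteq> \<rho>" for \<rho>'
  proof (rule ccontr)
    assume nz': "coef x \<rho>' \<noteq> 0"
    obtain t' where t': "is_tableau lam t'" "fits t' \<rho>'" using specht_coef_fits[OF x nz'] .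
    have off: "\<rho>' k = \<rho> k" if "k \<notin> U \<union> V" for k using that g by (simp add: garnir_set_def)
    have "\<exists>k\<in>{1..N}. \<rho> k \<noteq> \<rho>' k"
    proof -
      obtain k where k: "\<rho>' k \<noteq> \<rho> k" using ne by (meson ext)
      then have "k \<in> {1..N}" using off[of k] UN VN by blast
      then show ?thesis using k by (intro bexI[of _ k]) simp_all
    qed
    then obtain a where a: "a \<in> {1..N}" "\<rho> a \<noteq> \<rho>' a" "\<And>k. k \<in> {1..N} \<Longrightarrow> k > a \<Longrightarrow> \<rho> k = \<rho>' k"
      using largest_difference[of \<rho> \<rho>'] by blast
    \<comment> \<open>If the largest changed entry came from \<open>V\<close>, it would enter row
      \<open>i\<close> while the larger entries, among them all of \<open>U\<close>, stay put; row
      \<open>i\<close> would become too long.\<close>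
    have "a \<notin> V"
    proof
      assume aV: "a \<in> V"
      have row': "\<rho>' a = i" using g aV a(2) rV[OF aV] by (auto simp: garnir_set_def)
      have "{k \<in> {1..N}. \<rho> k = i} \<subseteq> {k \<in> {1..N}. \<rho>' k = i}"
      proof
        fix k assume k: "k \<in> {k \<in> {1..N}. \<rho> k = i}"
        have "\<rho>' k = i"
        proof (cases "k \<in> U")
          case True then show ?thesis using less[OF aV True] a(3)[of k] k by simp
        next
          case False then show ?thesis using off[of k] k rV[of k] by auto
        qed
        then show "k \<in> {k \<in> {1..N}. \<rho>' k = i}" using k by simp
      qed
      moreover have "a \<in> {k \<in> {1..N}. \<rho>' k = i}" "a \<notin> {k \<in> {1..N}. \<rho> k = i}"
        using a(1) row' rV[OF aV] by auto
      ultimately have "{k \<in> {1..N}. \<rho> k = i} \<subset> {k \<in> {1..N}. \<rho>' k = i}" by blast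
      then have "card {k \<in> {1..N}. \<rho> k = i} < card {k \<in> {1..N}. \<rho>' k = i}"
        by (intro psubset_card_mono) auto
      then show False using card_row[OF s] card_row[OF t'] by simp
    qed
    \<comment> \<open>So \<open>a\<close> drops from row \<open>i\<close> to the next row, which
      increases the weight, against the maximality of \<open>\<rho>\<close>.\<close>
    then have "a \<in> U" using off[of a] a(2) by (metis Un_iff)
    then have "\<rho> a = i" "\<rho>' a \<in> {i, Suc i}" using rU[of a] g by (simp_all add: garnir_set_def)
    then have "\<rho> a < \<rho>' a" using a(2) by auto
    then have "weight \<rho> < weight \<rho>'"
      using weight_less[OF a(1), of \<rho> \<rho>'] a(3) fits_bound[OF s] by blast
    then show False using max[OF nz'] by simp
  qed
  have self: "\<rho> \<in> garnir_set i (U \<union> V) \<rho>" using rU rV unfolding garnir_set_def by blast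
  have fin: "finite (garnir_set i (U \<union> V) \<rho>)"
    by (intro finite_garnir_set) (simp add: U_def V_def)
  have "(\<Sum>\<rho>'\<in>garnir_set i (U \<union> V) \<rho>. coef x \<rho>') = coef x \<rho>"
    by (subst sum.remove[OF fin self]) (simp add: sum.neutral zero)
  then show False using sum_coef_garnir_set[OF x _ card, of \<rho>] UN VN nz by simp
qed

text \<open>Rows are indexed from the top, so the name refers to the index: in every tabloid that
  occurs, \<open>N\<close> lies strictly above row \<open>m\<close>.\<close>

definition rows_below :: "nat \<Rightarrow> (tabloid \<Rightarrow>\<^sub>0 'a::field) set" where
  "rows_below m = {x \<in> specht lam. \<forall>\<rho>. coef x \<rho> \<noteq> 0 \<longrightarrow> \<rho> N < m}"

lemma subspace_rows_below: "fvs.subspace (rows_below m :: (tabloid \<Rightarrow>\<^sub>0 'a::field) set)"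
proof (rule fvs.subspaceI)
  show "(0 :: tabloid \<Rightarrow>\<^sub>0 'a) \<in> rows_below m"
    by (simp add: rows_below_def fvs.subspace_0[OF subspace_specht])
next
  fix x y :: "tabloid \<Rightarrow>\<^sub>0 'a" assume xy: "x \<in> rows_below m" "y \<in> rows_below m"
  have "\<rho> N < m" if "coef (x + y) \<rho> \<noteq> 0" for \<rho>
  proof -
    have "coef x \<rho> \<noteq> 0 \<or> coef y \<rho> \<noteq> 0" using that by (auto simp: coef_add)
    then show ?thesis using xy unfolding rows_below_def by blast
  qed
  then show "x + y \<in> rows_below m"
    using xy fvs.subspace_add[OF subspace_specht, of x y] by (simp add: rows_below_def)
next
  fix c and x :: "tabloid \<Rightarrow>\<^sub>0 'a" assume "x \<in> rows_below m"
  then show "scale_pm c x \<in> rows_below m"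
    using fvs.subspace_scale[OF subspace_specht, of x c] by (simp add: rows_below_def coef_scale)
qed

text \<open>Column permutations keep \<open>N\<close> in its column, so the foot of that column
  bounds its row. The tableau may be non-standard, as it is allowed to be in the non-vanishing
  argument.\<close>

lemma polytabloid_in_rows_below:
  assumes t: "is_tableau lam t"
    and z: "z \<in> D" "t z = N" and bottom: "\<And>i. (i, snd z) \<in> D \<Longrightarrow> i < m"
  shows "(polytabloid lam t :: tabloid \<Rightarrow>\<^sub>0 'a::field) \<in> rows_below m"
proof -
  have "\<rho> N < m" if nz: "icoef t \<rho> \<noteq> 0" for \<rho>
  proof -
    obtain \<pi> where pi: "\<pi> \<in> column_perms" "fits (t \<circ> \<pi>) \<rho>" using icoef_nonzero[OF nz] .
    note perm = column_permsD(1)[OF pi(1)] and col = column_permsD(2)[OF pi(1)]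
    obtain w where w: "w \<in> D" "\<pi> w = z" using z(1) permutes_image[OF perm] by (metis imageE)
    then have "\<rho> N = fst w" using pi(2) z(2) by (auto simp: fits_def)
    then show ?thesis using bottom[of "fst w"] w col[of w] by simp
  qed
  then have "\<rho> N < m" if "(of_int (icoef t \<rho>) :: 'a) \<noteq> 0" for \<rho>
    using that by (cases "icoef t \<rho> = 0") auto
  then show ?thesis
    using polytabloid_in_specht[OF t] by (simp add: rows_below_def coef_polytabloid[OF t])
qed

lemma standard_polytabloid_in_rows_below:
  assumes s: "is_tableau lam s" "column_increasing s" and z: "z \<in> D" "s z = N" "fst z < m"
  shows "(polytabloid lam s :: tabloid \<Rightarrow>\<^sub>0 'a::field) \<in> rows_below m"
proof (rule polytabloid_in_rows_below[OF s(1) z(1,2)])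
  fix i assume i: "(i, snd z) \<in> D"
  have "\<not> i > fst z"
  proof
    assume "i > fst z"
    then have "s (fst z, snd z) < s (i, snd z)" using s(2) i unfolding column_increasing_def by blast
    then show False using tableau_in[OF s(1) i] z(2) by simp
  qed
  then show "i < m" using z(3) by simp
qed

text \<open>Elimination of leading terms, as in the standard basis theorem: the heaviest tabloid of
  \<open>x\<close> comes from a standard tableau with \<open>N\<close> above row \<open>m\<close>,
  so a multiple of its polytabloid can be subtracted without leaving
  \<open>rows_below m\<close>.\<close>

lemma rows_below_subset_span:
  assumes "N > 0" and x: "x \<in> rows_below m"
  shows "x \<in> fvs.span {polytabloid lam s |s. standard_tableau lam s \<and> (\<exists>z\<in>D. s z = N \<and> fst z < m)}"
    (is "x \<in> fvs.span ?B")
proof -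
  \<comment> \<open>Induction on a strict upper bound \<open>W\<close> for the weights occurring in
    \<open>x\<close>.\<close>
  have "x \<in> rows_below m \<Longrightarrow> (\<And>\<rho>. coef x \<rho> \<noteq> 0 \<Longrightarrow> weight \<rho> < W) \<Longrightarrow> x \<in> fvs.span ?B"
    for W and x :: "tabloid \<Rightarrow>\<^sub>0 'a"
  proof (induction W arbitrary: x)
    case 0
    then have "x = 0" by (intro specht_eq_zero) (auto simp: rows_below_def)
    then show ?case by (simp add: fvs.span_zero)
  next
    case (Suc W)
    have x: "x \<in> specht lam" using Suc.prems(1) by (simp add: rows_below_def)
    show ?case
    proof (cases "\<exists>\<rho>. coef x \<rho> \<noteq> 0 \<and> weight \<rho> = W")
      case False
      then have "weight \<rho> < W" if "coef x \<rho> \<noteq> 0" for \<rho>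
        using Suc.prems(2)[OF that] that by (metis less_SucE)
      then show ?thesis using Suc.IH[OF Suc.prems(1)] by blast
    next
      case True
      then obtain \<rho> where \<rho>: "coef x \<rho> \<noteq> 0" "weight \<rho> = W" by blast
      obtain t where t: "is_tableau lam t" "fits t \<rho>" using specht_coef_fits[OF x \<rho>(1)] .
      obtain s where s: "is_tableau lam s" "fits s \<rho>"
        and rows: "\<And>i j j'. j < j' \<Longrightarrow> (i, j') \<in> D \<Longrightarrow> s (i, j) < s (i, j')"
        using row_increasing_tableau[OF t] by blast
      have "weight \<rho>' \<le> weight \<rho>" if "coef x \<rho>' \<noteq> 0" for \<rho>'
        using Suc.prems(2)[OF that] \<rho>(2) by simp
      then have cols: "column_increasing s"
        by (rule coef_maximal_column_increasing[OF x \<rho>(1) _ s rows])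
      have std: "standard_tableau lam s"
        using s(1) rows cols by (auto simp: standard_tableau_def column_increasing_def)
      have "N \<in> s ` D" using tableau_image[OF s(1)] assms(1) by simp
      then obtain z where z: "z \<in> D" "s z = N" by blast
      have "\<rho> N < m" using Suc.prems(1) \<rho>(1) by (auto simp: rows_below_def)
      moreover have "\<rho> N = fst z" using s(2) z by (auto simp: fits_def)
      ultimately have zm: "fst z < m" by simp
      define e where "e = (polytabloid lam s :: tabloid \<Rightarrow>\<^sub>0 'a)"
      have e: "e \<in> rows_below m" "e \<in> ?B"
        using standard_polytabloid_in_rows_below[OF s(1) cols z zm] std z zm by (auto simp: e_def)
      have ce: "coef e \<rho>' = of_int (icoef s \<rho>')" for \<rho>' by (simp add: e_def coef_polytabloid[OF s(1)])
      define y where "y = x - scale_pm (coef x \<rho>) e"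
      have yrows: "y \<in> rows_below m"
        unfolding y_def using Suc.prems(1) e(1)
        by (intro fvs.subspace_diff fvs.subspace_scale subspace_rows_below)
      \<comment> \<open>At \<open>\<rho>\<close> itself the leading coefficient 1 of
        \<open>e\<close> gives cancellation. Any other tabloid of \<open>y\<close> is lighter as a
        tabloid of \<open>e\<close>, or occurs in \<open>x\<close>, where weight \<open>W\<close> is
        excluded because weights separate tabloids.\<close>
      have "weight \<rho>' < W" if y0: "coef y \<rho>' \<noteq> 0" for \<rho>'
      proof (cases "\<exists>k\<in>{1..N}. \<rho>' k \<noteq> \<rho> k")
        case False
        then have "coef z \<rho>' = coef z \<rho>" for z :: "tabloid \<Rightarrow>\<^sub>0 'a" by (intro coef_cong) auto
        then have "coef y \<rho>' = 0"
          by (simp add: y_def coef_diff coef_scale ce icoef_self[OF s])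
        then show ?thesis using y0 by simp
      next
        case True
        then obtain k where k: "k \<in> {1..N}" "\<rho>' k \<noteq> \<rho> k" by blast
        show ?thesis
        proof (cases "icoef s \<rho>' = 0")
          case False
          then show ?thesis using icoef_column_increasing_less[OF s(1) cols False s(2) k] \<rho>(2) by simp
        next
          case True
          then have x0: "coef x \<rho>' \<noteq> 0" using y0 by (simp add: y_def coef_diff coef_scale ce)
          obtain t' where t': "is_tableau lam t'" "fits t' \<rho>'" using specht_coef_fits[OF x x0] .
          have "weight \<rho>' \<noteq> W" using weight_inj[OF t' s _ k(1)] k(2) \<rho>(2) by metis
          then show ?thesis using Suc.prems(2)[OF x0] by simp
        qed
      qed
      then have "y \<in> fvs.span ?B" using Suc.IH[OF yrows] by blast
      then have "y + scale_pm (coef x \<rho>) e \<in> fvs.span ?B"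
        using e(2) by (intro fvs.span_add fvs.span_scale[OF fvs.span_base])
      then show ?thesis by (simp add: y_def)
    qed
  qed
  \<comment> \<open>The row indices of the diagram are bounded, which starts the induction.\<close>
  moreover have "weight \<rho> < Suc (weight (\<lambda>_. Max (fst ` D)))" if nz: "coef x \<rho> \<noteq> 0" for \<rho>
  proof -
    have "x \<in> specht lam" using x by (simp add: rows_below_def)
    then obtain t where "is_tableau lam t" "fits t \<rho>" using specht_coef_fits nz by blast
    then show ?thesis unfolding weight_def less_Suc_eq_le
      using fits_bound by (intro sum_mono mult_right_mono) auto
  qed
  ultimately show ?thesis using x by blast
qed

section \<open>The Specht series\<close>

lemma finite_removable_rows [simp]: "finite (removable_rows lam)"
  using part by (rule_tac finite_subset[of _ "{i. lam i \<noteq> 0}"]) (auto simp: removable_rows_def partition_of_def)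

lemma removable_row_bij: "bij_betw (removable_row lam) {1..num_removable lam} (removable_rows lam)"
proof -
  have "bij_betw ((!) (sorted_list_of_set (removable_rows lam))) {..<num_removable lam} (removable_rows lam)"
    by (rule bij_betw_nth) (simp_all add: num_removable_def)
  moreover have "bij_betw (\<lambda>k. k - 1) {1..num_removable lam} {..<num_removable lam}"
    by (rule bij_betw_byWitness[where f' = Suc]) auto
  ultimately show ?thesis
    unfolding removable_row_def using bij_betw_trans by (fastforce simp: o_def)
qed

lemma removable_row_less:
  assumes "1 \<le> j" "j < k" "k \<le> num_removable lam"
  shows "removable_row lam j < removable_row lam k"
  using strict_sorted_list_of_set[of "removable_rows lam"] assms
  by (auto simp: removable_row_def num_removable_def sorted_wrt_iff_nth_less)

lemma removable_row_le_iff: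
  assumes "j \<in> {1..num_removable lam}" "k \<in> {1..num_removable lam}"
  shows "removable_row lam j \<le> removable_row lam k \<longleftrightarrow> j \<le> k"
  using removable_row_less[of j k] removable_row_less[of k j] assms
  by (cases j k rule: linorder_cases) auto

lemma removable_row_mem: "k \<in> {1..num_removable lam} \<Longrightarrow> removable_row lam k \<in> removable_rows lam"
  using removable_row_bij by (auto simp: bij_betw_def)

lemma removable_node_in: "k \<in> {1..num_removable lam} \<Longrightarrow> removable_node lam k \<in> D"
  and removable_node_bottom: "k \<in> {1..num_removable lam} \<Longrightarrow> (i, snd (removable_node lam k)) \<in> D
    \<Longrightarrow> i \<le> removable_row lam k"
proof -
  assume k: "k \<in> {1..num_removable lam}"
  have less: "lam (Suc (removable_row lam k)) < lam (removable_row lam k)"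
    using removable_row_mem[OF k] by (simp add: removable_rows_def)
  then show "removable_node lam k \<in> D" by (simp add: in_diagram removable_node_def)
  assume i: "(i, snd (removable_node lam k)) \<in> D"
  show "i \<le> removable_row lam k"
  proof (rule ccontr)
    assume "\<not> i \<le> removable_row lam k"
    then have "lam i \<le> lam (Suc (removable_row lam k))" by (intro lam_antimono) simp
    then show False using i less by (simp add: in_diagram removable_node_def)
  qed
qed

text \<open>Being the largest entry, \<open>N\<close> has no node to its right or below it.\<close>

lemma standard_tableau_removable:
  assumes s: "standard_tableau lam s" and z: "z \<in> D" "s z = N"
  obtains k where "k \<in> {1..num_removable lam}" "z = removable_node lam k"
proof -
  have t: "is_tableau lam s" using s by (simp add: standard_tableau_def)
  have right: "(fst z, Suc (snd z)) \<notin> D"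
  proof
    assume a: "(fst z, Suc (snd z)) \<in> D"
    then have "s (fst z, snd z) < s (fst z, Suc (snd z))"
      using s unfolding standard_tableau_def by blast
    then show False using tableau_in[OF t a] z(2) by simp
  qed
  have below: "(Suc (fst z), snd z) \<notin> D"
  proof
    assume a: "(Suc (fst z), snd z) \<in> D"
    then have "s (fst z, snd z) < s (Suc (fst z), snd z)"
      using s unfolding standard_tableau_def by blast
    then show False using tableau_in[OF t a] z(2) by simp
  qed
  have "lam (fst z) = Suc (snd z)" "lam (Suc (fst z)) \<le> snd z"
    using right below z(1) by (auto simp: in_diagram)
  moreover from this have "fst z \<in> removable_rows lam" by (simp add: removable_rows_def)
  then obtain k where "k \<in> {1..num_removable lam}" "fst z = removable_row lam k"
    using removable_row_bij unfolding bij_betw_def by blast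
  ultimately show ?thesis using that[of k] by (simp add: removable_node_def prod_eq_iff)
qed

text \<open>\<open>M\<close> is any threshold separating the rows of the first \<open>i\<close>
  removable nodes from those of the others. As \<open>N\<close> is at a removable node of every
  standard tableau, the spanning set found above is the one defining the series.\<close>

lemma specht_series_eq_rows_below:
  assumes "N > 0" and "i \<le> num_removable lam"
    and M: "\<And>k. k \<in> {1..num_removable lam} \<Longrightarrow> removable_row lam k < M \<longleftrightarrow> k \<le> i"
  shows "(specht_series lam i :: (tabloid \<Rightarrow>\<^sub>0 'a::field) set) = rows_below M"
proof
  show "(specht_series lam i :: (tabloid \<Rightarrow>\<^sub>0 'a) set) \<subseteq> rows_below M"
    unfolding specht_series_def
  proof (rule fvs.span_minimal[OF _ subspace_rows_below], clarify)
    fix s k assume s: "standard_tableau lam s" and k: "k \<in> {1..i}" "s (removable_node lam k) = card D"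
    have k': "k \<in> {1..num_removable lam}" using k(1) assms(2) by auto
    have "is_tableau lam s" "column_increasing s"
      using s by (auto simp: standard_tableau_def column_increasing_def)
    then show "(polytabloid lam s :: tabloid \<Rightarrow>\<^sub>0 'a) \<in> rows_below M"
      using standard_polytabloid_in_rows_below[OF _ _ removable_node_in[OF k']] k M[OF k']
      by (simp add: removable_node_def)
  qed
  show "(rows_below M :: (tabloid \<Rightarrow>\<^sub>0 'a) set) \<subseteq> specht_series lam i"
  proof
    fix x :: "tabloid \<Rightarrow>\<^sub>0 'a" assume "x \<in> rows_below M"
    then have "x \<in> fvs.span {polytabloid lam s |s. standard_tableau lam s \<and> (\<exists>z\<in>D. s z = N \<and> fst z < M)}"
      by (rule rows_below_subset_span[OF assms(1)])
    also have "\<dots> \<subseteq> specht_series lam i"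
      unfolding specht_series_def
    proof (rule fvs.span_mono, rule subsetI)
      fix y :: "tabloid \<Rightarrow>\<^sub>0 'a"
      assume "y \<in> {polytabloid lam s |s. standard_tableau lam s \<and> (\<exists>z\<in>D. s z = N \<and> fst z < M)}"
      then obtain s z where y: "y = polytabloid lam s" and s: "standard_tableau lam s"
        and z: "z \<in> D" "s z = N" "fst z < M" by blast
      obtain k where k: "k \<in> {1..num_removable lam}" "z = removable_node lam k"
        using standard_tableau_removable[OF s z(1,2)] .
      have "k \<in> {1..i}" using M[OF k(1)] k z(3) by (simp add: removable_node_def)
      then have "\<exists>k\<in>{1..i}. s (removable_node lam k) = card D"
        using z(2) k(2) by (intro bexI[of _ k]) simp_all
      then show "y \<in> {polytabloid lam s |s. standard_tableau lam s \<and>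
          (\<exists>k\<in>{1..i}. s (removable_node lam k) = card D)}"
        using y s by blast
    qed
    finally show "x \<in> specht_series lam i" .
  qed
qed

text \<open>Both members are expressed through the row of the \<open>i\<close>-th removable node;
  this includes the case \<open>i - 1 = 0\<close>, which has no removable node of its own.\<close>

lemma specht_series_eq:
  assumes "i \<in> {1..num_removable lam}" "N > 0"
  shows "specht_series lam i = rows_below (Suc (removable_row lam i))"
    and "specht_series lam (i - 1) = rows_below (removable_row lam i)"
proof -
  have 1: "removable_row lam k < Suc (removable_row lam i) \<longleftrightarrow> k \<le> i"
    if "k \<in> {1..num_removable lam}" for k
    using removable_row_le_iff[OF that assms(1)] by (simp add: less_Suc_eq_le)
  show "specht_series lam i = rows_below (Suc (removable_row lam i))"
    by (rule specht_series_eq_rows_below[OF assms(2) _ 1]) (use assms(1) in simp_all)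
  have 2: "removable_row lam k < removable_row lam i \<longleftrightarrow> k \<le> i - 1"
    if "k \<in> {1..num_removable lam}" for k
    using removable_row_le_iff[OF assms(1) that] assms(1) that by auto
  show "specht_series lam (i - 1) = rows_below (removable_row lam i)"
    by (rule specht_series_eq_rows_below[OF assms(2) _ 2]) (use assms(1) in auto)
qed

text \<open>Permutations of \<open>{1..n}\<close> fix \<open>N\<close> and hence do not change its
  row in a tabloid.\<close>

lemma sym_submodule_rows_below:
  assumes "N = Suc n"
  shows "sym_submodule n (rows_below m :: (tabloid \<Rightarrow>\<^sub>0 'a::field) set)"
proof -
  have single: "act x (Poly_Mapping.single \<sigma> c) \<in> rows_below m"
    if x: "x \<in> rows_below m" and s: "\<sigma> permutes {1..n}" for x :: "tabloid \<Rightarrow>\<^sub>0 'a" and \<sigma> c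
  proof -
    have sN: "\<sigma> permutes {1..N}" using permutes_subset[OF s, of "{1..N}"] assms by auto
    have "\<sigma> N = N" using permutes_not_in[OF s, of N] assms by simp
    then have "\<rho> N < m" if "coef (act x (Poly_Mapping.single \<sigma> c)) \<rho> \<noteq> 0" for \<rho>
      using x that unfolding coef_act_single[OF sN] rows_below_def by force
    moreover have "Poly_Mapping.single \<sigma> c \<in> sym_group_alg N" using sN by (auto simp: sym_group_alg_def)
    ultimately show ?thesis using x act_in_specht by (auto simp: rows_below_def)
  qed
  have "act x a \<in> rows_below m" if "x \<in> rows_below m" "a \<in> sym_group_alg n"
    for x :: "tabloid \<Rightarrow>\<^sub>0 'a" and a
    using that single
    by (subst poly_mapping_sum_single[of a], subst act_sum_right)
      (auto simp: sym_group_alg_def intro!: fvs.subspace_sum[OF subspace_rows_below])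
  then show ?thesis by (simp add: sym_submodule_def subspace_rows_below)
qed

section \<open>The action of the Jucys-Murphy element\<close>

lemma fits_row_swap:
  assumes "z \<in> D" "w \<in> D" "fst z = fst w"
  shows "fits (t \<circ> transpose z w) \<rho> \<longleftrightarrow> fits t \<rho>"
proof -
  have *: "fits (t \<circ> transpose z w) \<rho>" if "fits t \<rho>" for t
    unfolding fits_def
  proof
    fix x assume "x \<in> D"
    then have "transpose z w x \<in> D" "fst (transpose z w x) = fst x"
      using assms by (auto simp: transpose_def)
    then show "\<rho> ((t \<circ> transpose z w) x) = fst x" using that by (simp add: fits_def)
  qed
  show ?thesis using *[of t] *[of "t \<circ> transpose z w"] by (auto simp: o_assoc[symmetric])
qed

text \<open>
  Let \<open>n + 1\<close> be at \<open>q\<close> in \<open>s\<close> and apply to \<open>s\<close> a column permutation moving \<open>n + 1\<close> to \<open>z\<close>,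
  followed by the exchange of \<open>n + 1\<close> with the entry at \<open>y\<close>.  If the row of \<open>y\<close> is below that of \<open>z\<close> and
  \<open>y\<close> is in another column, then the terms cancel in pairs: swapping the entries at \<open>y\<close> and at the node
  of its column in the row of \<open>z\<close> does not change the tabloid.
\<close>

lemma sum_exchange_terms:
  assumes s: "is_tableau lam s" and q: "(r, c) \<in> D" "(Suc r, c) \<notin> D" "s (r, c) = N"
    and \<rho>: "\<rho> N \<ge> r" and z: "z \<in> D" "snd z = c" and y: "y \<in> D" "y \<noteq> z"
  shows "(\<Sum>\<pi> | \<pi> \<in> column_perms \<and> \<pi> z = (r, c). if fits (s \<circ> \<pi> \<circ> transpose y z) \<rho> then sign \<pi> else 0)
    = (if z = (r, c) \<and> fst y = r then icoef s \<rho> else 0) - (if z \<noteq> (r, c) \<and> y = (r, c) then icoef s \<rho> else 0)"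
    (is "?G = ?R")
proof -
  let ?q = "(r, c)"
  let ?C = "\<lambda>z. {\<pi>. \<pi> \<in> column_perms \<and> \<pi> z = ?q}"
  have bottom: "i \<le> r" if "(i, c) \<in> D" for i
    using diagram_down_closed[OF that, of "Suc r" c] q(2) by (metis le_refl not_less_eq_eq)
  have zr: "fst z \<le> r" using bottom[of "fst z"] z by (metis prod.collapse)
  \<comment> \<open>The node \<open>(r, c)\<close> is the foot of its column, so for
    \<open>\<rho> N \<ge> r\<close> only column permutations fixing it can fit
    \<open>\<rho>\<close>.\<close>
  have icoef: "icoef s \<rho> = (\<Sum>\<pi>\<in>?C ?q. if fits (s \<circ> \<pi>) \<rho> then sign \<pi> else 0)"
  proof -
    have "\<pi> ?q = ?q" if pi: "\<pi> \<in> column_perms" "fits (s \<circ> \<pi>) \<rho>" for \<pi>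
    proof -
      obtain w where w: "w \<in> D" "\<pi> w = ?q"
        using q(1) permutes_image[OF column_permsD(1)[OF pi(1)]] by (metis imageE)
      have "\<rho> N = fst w" using pi(2) w q(3) by (auto simp: fits_def)
      moreover have "snd w = c" using column_permsD(2)[OF pi(1), of w] w(2) by simp
      ultimately have "w = ?q" using bottom[of "fst w"] w(1) \<rho> by (cases w) auto
      then show ?thesis using w(2) by simp
    qed
    then have "{\<pi>. \<pi> \<in> column_perms \<and> fits (s \<circ> \<pi>) \<rho>} = {\<pi> \<in> ?C ?q. fits (s \<circ> \<pi>) \<rho>}" by blast
    moreover have "finite (?C ?q)" by simp
    ultimately show ?thesis unfolding icoef_def by (simp only: sum.inter_filter)
  qed
  consider "\<not> fst y \<ge> r" | "fst y \<ge> r" "fst y = fst z" | "fst y \<ge> r" "fst y \<noteq> fst z" "snd y = c"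
    | "fst y \<ge> r" "fst y \<noteq> fst z" "snd y \<noteq> c" by blast
  then show ?thesis
  proof cases
    \<comment> \<open>After the exchange \<open>N\<close> is at \<open>y\<close>, above row
      \<open>r\<close>, whereas \<open>\<rho>\<close> puts it in row \<open>r\<close> or
      lower.\<close>
    case 1
    have "\<not> fits (s \<circ> \<pi> \<circ> transpose y z) \<rho>" if "\<pi> \<in> ?C z" for \<pi>
      using y(1) that q(3) \<rho> 1 by (auto simp: fits_def intro!: bexI[of _ y])
    then have "?G = 0" by (intro sum.neutral) auto
    moreover have "?R = 0" using 1 by auto
    ultimately show ?thesis by simp
  next
    \<comment> \<open>Here \<open>z\<close> must be \<open>(r, c)\<close>; the exchange stays within
      a row and does not change the tabloid.\<close>
    case 2
    then have zq: "z = ?q" using zr z by (cases z) auto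
    have "?G = (\<Sum>\<pi>\<in>?C ?q. if fits (s \<circ> \<pi>) \<rho> then sign \<pi> else 0)"
      using fits_row_swap[OF y(1) z(1) 2(2)] by (simp add: zq)
    then show ?thesis using 2 zq icoef by simp
  next
    \<comment> \<open>Here \<open>y\<close> must be \<open>(r, c)\<close>; the exchange is itself a
      column transposition and costs a sign.\<close>
    case 3
    then have yq: "y = ?q" using y(1) bottom[of "fst y"] by (cases y) auto
    have zq: "z \<noteq> ?q" using y(2) yq by simp
    have "?G = (\<Sum>\<pi>\<in>?C ?q. - (if fits (s \<circ> \<pi>) \<rho> then sign \<pi> else 0))"
    proof (rule sum.reindex_bij_witness[where i = "\<lambda>\<pi>. \<pi> \<circ> transpose y z" and j = "\<lambda>\<pi>. \<pi> \<circ> transpose y z"])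
      fix \<pi> assume "\<pi> \<in> ?C z"
      then show "\<pi> \<circ> transpose y z \<in> ?C ?q"
        using column_perms_swap[OF _ y(1) z(1), of \<pi>] z(2) yq by simp
      show "- (if fits (s \<circ> (\<pi> \<circ> transpose y z)) \<rho> then sign (\<pi> \<circ> transpose y z) else 0)
          = (if fits (s \<circ> \<pi> \<circ> transpose y z) \<rho> then sign \<pi> else 0)"
        using sign_column_perms_swap[OF _ y(2), of \<pi>] \<open>\<pi> \<in> ?C z\<close> by (simp add: o_assoc)
    next
      fix \<pi> assume "\<pi> \<in> ?C ?q"
      then show "\<pi> \<circ> transpose y z \<in> ?C z"
        using column_perms_swap[OF _ y(1) z(1), of \<pi>] z(2) yq by simp
    qed (simp_all add: o_assoc[symmetric])
    then show ?thesis using yq zq icoef by (simp add: sum_negf)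
  next
    case 4
    define p where "p = (fst z, snd y)"
    have py: "p \<noteq> y" "snd p = snd y" using 4(2) by (auto simp: p_def prod_eq_iff)
    have pD: "p \<in> D" using diagram_down_closed[of "fst y" "snd y" "fst z" "snd y"] y(1) 4(1) zr by (simp add: p_def)
    have zn: "z \<noteq> p" "z \<noteq> y" using 4(3) z(2) py(2) by auto
    have "?G = 0"
    proof (rule sum_sign_reversing_involution[where g = "\<lambda>\<pi>. \<pi> \<circ> transpose p y"])
      fix \<pi> assume pi: "\<pi> \<in> ?C z"
      then show "\<pi> \<circ> transpose p y \<in> ?C z"
        using column_perms_swap[OF _ pD y(1) py(2), of \<pi>] zn by (simp add: transpose_def)
      show "\<pi> \<circ> transpose p y \<circ> transpose p y = \<pi>" by (simp add: o_assoc[symmetric])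
      \<comment> \<open>Carried past the exchange, the swap of \<open>p\<close> and \<open>y\<close>
        becomes a swap of \<open>z\<close> and \<open>p\<close>, which lie in one row.\<close>
      have "transpose p y \<circ> transpose y z = transpose y z \<circ> transpose z p"
        using zn py(1) by (auto simp: fun_eq_iff transpose_def)
      then have "s \<circ> (\<pi> \<circ> transpose p y) \<circ> transpose y z = s \<circ> \<pi> \<circ> transpose y z \<circ> transpose z p"
        by (simp only: o_assoc[symmetric])
      then have "fits (s \<circ> (\<pi> \<circ> transpose p y) \<circ> transpose y z) \<rho> \<longleftrightarrow> fits (s \<circ> \<pi> \<circ> transpose y z) \<rho>"
        using fits_row_swap[OF z(1) pD] by (simp add: p_def)
      then show "(if fits (s \<circ> (\<pi> \<circ> transpose p y) \<circ> transpose y z) \<rho> then sign (\<pi> \<circ> transpose p y) else 0)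
          = - (if fits (s \<circ> \<pi> \<circ> transpose y z) \<rho> then sign \<pi> else 0)"
        using sign_column_perms_swap[OF _ py(1), of \<pi>] pi by simp
    qed
    moreover have "?R = 0" using 4 by auto
    ultimately show ?thesis by simp
  qed
qed

text \<open>The surviving exchanges are those of \<open>(r, c)\<close> with the \<open>c\<close>
  other nodes of its row, counted positively, and those of the \<open>r\<close> higher nodes of its
  column with \<open>(r, c)\<close>, counted negatively; the balance is the residue.\<close>

lemma sum_icoef_transpose:
  assumes s: "is_tableau lam s" and q: "lam r = Suc c" "(Suc r, c) \<notin> D" "s (r, c) = N"
    and \<rho>: "\<rho> N \<ge> r"
  shows "(\<Sum>i\<in>{1..<N}. icoef s (\<rho> \<circ> transpose i N)) = (int c - int r) * icoef s \<rho>"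
proof -
  let ?q = "(r, c)"
  have qD: "?q \<in> D" using q(1) by (simp add: diagram_def)
  define Col where "Col = {z \<in> D. snd z = c}"
  have ColI: "Col = (\<lambda>i. (i, c)) ` {..r}"
  proof (intro set_eqI iffI)
    fix z assume z: "z \<in> Col"
    have "fst z \<le> r"
      using z diagram_down_closed[of "fst z" c "Suc r" c] q(2) by (force simp: Col_def)
    then show "z \<in> (\<lambda>i. (i, c)) ` {..r}" using z by (force simp: Col_def)
  qed (use diagram_down_closed[OF qD] in \<open>auto simp: Col_def\<close>)
  have finCol: "finite Col" by (simp add: Col_def)
  define F where "F \<pi> y z = (if fits (s \<circ> \<pi> \<circ> transpose y z) \<rho> then sign \<pi> else 0)" for \<pi> y z
  \<comment> \<open>Exchanging the entry \<open>i\<close> with \<open>N\<close> amounts to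
    exchanging the nodes that they occupy in \<open>s \<circ> \<pi>\<close>; \<open>N\<close> is at
    \<open>inv \<pi> (r, c)\<close>.\<close>
  have inner: "(\<Sum>i\<in>{1..<N}. if fits (s \<circ> \<pi>) (\<rho> \<circ> transpose i N) then sign \<pi> else 0)
      = (\<Sum>y\<in>D - {inv \<pi> ?q}. F \<pi> y (inv \<pi> ?q))" if pi: "\<pi> \<in> column_perms" for \<pi>
  proof -
    let ?z = "inv \<pi> ?q"
    let ?X = "s \<circ> \<pi>"
    note perm = column_permsD(1)[OF pi]
    have X: "is_tableau lam ?X" by (rule tableau_comp_right[OF perm s])
    have z: "?z \<in> D" "?X ?z = N"
      using permutes_in_image[OF permutes_inv[OF perm], of ?q] qD q(3) permutes_inverses(1)[OF perm] by auto
    have bij: "bij_betw ?X (D - {?z}) {1..<N}"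
    proof -
      have "bij_betw ?X (D - {?z}) ({1..N} - {?X ?z})"
        using tableau_bij[OF X] z(1) by (intro bij_betw_DiffI) (auto simp: bij_betw_def)
      moreover have "{1..N} - {?X ?z} = {1..<N}" unfolding z(2) by auto
      ultimately show ?thesis by simp
    qed
    have "fits ?X (\<rho> \<circ> transpose (?X y) N) \<longleftrightarrow> fits (?X \<circ> transpose y ?z) \<rho>" if y: "y \<in> D" for y
    proof -
      have "transpose (?X y) N (?X w) = ?X (transpose y ?z w)" if "w \<in> D" for w
        using tableau_eq_iff[OF X that y] tableau_eq_iff[OF X that z(1)] z(2)
        by (auto simp: transpose_def)
      then show ?thesis by (auto simp: fits_def)
    qed
    then have "(\<Sum>y\<in>D - {?z}. F \<pi> y ?z)
        = (\<Sum>y\<in>D - {?z}. if fits ?X (\<rho> \<circ> transpose (?X y) N) then sign \<pi> else 0)"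
      unfolding F_def by (intro sum.cong refl) simp
    also have "\<dots> = (\<Sum>i\<in>{1..<N}. if fits ?X (\<rho> \<circ> transpose i N) then sign \<pi> else 0)"
      by (rule sum.reindex_bij_betw[OF bij])
    finally show ?thesis by simp
  qed
  have inv: "inv \<pi> ?q = z \<longleftrightarrow> \<pi> z = ?q" if "\<pi> \<in> column_perms" for \<pi> z
    using permutes_inv_eq[OF column_permsD(1)[OF that]] by simp
  have "(\<Sum>i\<in>{1..<N}. icoef s (\<rho> \<circ> transpose i N))
      = (\<Sum>i\<in>{1..<N}. \<Sum>\<pi>\<in>column_perms. if fits (s \<circ> \<pi>) (\<rho> \<circ> transpose i N) then sign \<pi> else 0)"
    by (simp add: icoef_def sum.inter_filter[symmetric] del: sum.op_ivl_Suc)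
  also have "\<dots> = (\<Sum>\<pi>\<in>column_perms. \<Sum>i\<in>{1..<N}. if fits (s \<circ> \<pi>) (\<rho> \<circ> transpose i N) then sign \<pi> else 0)"
    by (rule sum.swap)
  also have "\<dots> = (\<Sum>\<pi>\<in>column_perms. \<Sum>y\<in>D - {inv \<pi> ?q}. F \<pi> y (inv \<pi> ?q))"
    by (intro sum.cong refl inner)
  \<comment> \<open>The column permutations are grouped by the node to which they bring
    \<open>N\<close>.\<close>
  also have "\<dots> = (\<Sum>z\<in>Col. \<Sum>\<pi> | \<pi> \<in> column_perms \<and> inv \<pi> ?q = z. \<Sum>y\<in>D - {inv \<pi> ?q}. F \<pi> y (inv \<pi> ?q))"
  proof (rule sum.group[symmetric, OF finite_column_perms finCol], rule image_subsetI)
    fix \<pi> assume pi: "\<pi> \<in> column_perms"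
    note perm = column_permsD(1)[OF pi]
    have "inv \<pi> ?q \<in> D" using permutes_in_image[OF permutes_inv[OF perm], of ?q] qD by simp
    moreover have "snd (inv \<pi> ?q) = c"
      using column_permsD(2)[OF pi, of "inv \<pi> ?q"] permutes_inverses(1)[OF perm] by simp
    ultimately show "inv \<pi> ?q \<in> Col" by (simp add: Col_def)
  qed
  also have "\<dots> = (\<Sum>z\<in>Col. \<Sum>\<pi> | \<pi> \<in> column_perms \<and> \<pi> z = ?q. \<Sum>y\<in>D - {z}. F \<pi> y z)"
  proof (intro sum.cong[OF refl])
    fix z
    show "(\<Sum>\<pi> | \<pi> \<in> column_perms \<and> inv \<pi> ?q = z. \<Sum>y\<in>D - {inv \<pi> ?q}. F \<pi> y (inv \<pi> ?q))
        = (\<Sum>\<pi> | \<pi> \<in> column_perms \<and> \<pi> z = ?q. \<Sum>y\<in>D - {z}. F \<pi> y z)"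
    proof (rule sum.cong)
      show "{\<pi>. \<pi> \<in> column_perms \<and> inv \<pi> ?q = z} = {\<pi>. \<pi> \<in> column_perms \<and> \<pi> z = ?q}"
        using inv by blast
    next
      fix \<pi> assume "\<pi> \<in> {\<pi>. \<pi> \<in> column_perms \<and> \<pi> z = ?q}"
      then have "inv \<pi> ?q = z" using inv by blast
      then show "(\<Sum>y\<in>D - {inv \<pi> ?q}. F \<pi> y (inv \<pi> ?q)) = (\<Sum>y\<in>D - {z}. F \<pi> y z)" by simp
    qed
  qed
  also have "\<dots> = (\<Sum>z\<in>Col. \<Sum>y\<in>D - {z}. \<Sum>\<pi> | \<pi> \<in> column_perms \<and> \<pi> z = ?q. F \<pi> y z)"
    by (intro sum.cong refl sum.swap)
  also have "\<dots> = (\<Sum>z\<in>Col. \<Sum>y\<in>D - {z}. (if z = ?q \<and> fst y = r then icoef s \<rho> else 0)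
      - (if z \<noteq> ?q \<and> y = ?q then icoef s \<rho> else 0))"
    unfolding F_def
    by (intro sum.cong refl sum_exchange_terms[where r = r and c = c and s = s and \<rho> = \<rho>, OF s qD q(2,3) \<rho>])
      (simp_all add: Col_def)
  also have "\<dots> = (\<Sum>z\<in>Col. if z = ?q then int c * icoef s \<rho> else - icoef s \<rho>)"
  proof (intro sum.cong refl)
    fix z assume "z \<in> Col"
    show "(\<Sum>y\<in>D - {z}. (if z = ?q \<and> fst y = r then icoef s \<rho> else 0)
        - (if z \<noteq> ?q \<and> y = ?q then icoef s \<rho> else 0))
      = (if z = ?q then int c * icoef s \<rho> else - icoef s \<rho>)"
    proof (cases "z = ?q")
      case True
      have "{y \<in> D - {?q}. fst y = r} = (\<lambda>j. (r, j)) ` {..<c}"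
        using q(1) by (auto simp: diagram_def)
      then have "card {y \<in> D - {?q}. fst y = r} = c" by (simp add: card_image inj_on_def)
      then show ?thesis using True by (simp add: sum.inter_filter[symmetric])
    next
      case False
      then have "?q \<in> D - {z}" using qD by simp
      then show ?thesis using False by (simp add: sum_negf)
    qed
  qed
  also have "\<dots> = int c * icoef s \<rho> + (\<Sum>z\<in>Col - {?q}. - icoef s \<rho>)"
    using finCol qD by (subst sum.remove[of _ ?q]) (auto simp: Col_def)
  also have "card (Col - {?q}) = r"
  proof -
    have "card Col = Suc r" unfolding ColI by (subst card_image) (auto simp: inj_on_def)
    then show ?thesis using finCol qD by (simp add: Col_def)
  qed
  then have "(\<Sum>z\<in>Col - {?q}. - icoef s \<rho>) = - (int r * icoef s \<rho>)" by simp
  finally show ?thesis by (simp only: left_diff_distrib add_uminus_conv_diff)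
qed

text \<open>The integer identity above holds at all \<open>\<rho>\<close> with \<open>N\<close> in
  row \<open>r\<close> or lower, so the difference involves only tabloids with \<open>N\<close>
  above row \<open>r\<close>.\<close>

lemma jucys_murphy_polytabloid:
  assumes s: "is_tableau lam s" and k: "k \<in> {1..num_removable lam}" and sN: "s (removable_node lam k) = N"
  shows "act (polytabloid lam s) (jucys_murphy N)
      - scale_pm (of_int (residue (removable_node lam k))) (polytabloid lam s)
    \<in> (rows_below (removable_row lam k) :: (tabloid \<Rightarrow>\<^sub>0 'a::field) set)"
proof -
  define r where "r = removable_row lam k"
  define c where "c = lam r - 1"
  define e where "e = (polytabloid lam s :: tabloid \<Rightarrow>\<^sub>0 'a)"
  have node: "removable_node lam k = (r, c)" by (simp add: removable_node_def r_def c_def)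
  have in_D: "(r, c) \<in> D" using removable_node_in[OF k] node by simp
  have lamr: "lam r = Suc c" using in_D by (simp add: diagram_def c_def)
  have below: "(Suc r, c) \<notin> D" using removable_node_bottom[OF k, of "Suc r"] node by (auto simp: r_def)
  have "\<rho> N < r" if nz: "coef (act e (jucys_murphy N) - scale_pm (of_int (int c - int r)) e) \<rho> \<noteq> 0" for \<rho>
  proof (rule ccontr)
    assume "\<not> \<rho> N < r"
    then have "(\<Sum>i\<in>{1..<N}. icoef s (\<rho> \<circ> transpose i N)) = (int c - int r) * icoef s \<rho>"
      using sum_icoef_transpose[OF s lamr below] sN node by simp
    then have "(\<Sum>i\<in>{1..<N}. of_int (icoef s (\<rho> \<circ> transpose i N))) = (of_int ((int c - int r) * icoef s \<rho>) :: 'a)"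
      by (metis of_int_sum)
    then show False
      using nz by (simp add: e_def coef_diff coef_scale coef_act_jucys_murphy coef_polytabloid[OF s] del: sum.op_ivl_Suc)
  qed
  moreover have "act e (jucys_murphy N) - scale_pm (of_int (int c - int r)) e \<in> specht lam"
    using polytabloid_in_specht[OF s] act_in_specht[OF _ jucys_murphy_in_sym_group_alg]
    by (auto simp: e_def intro!: fvs.subspace_diff[OF subspace_specht] fvs.subspace_scale[OF subspace_specht])
  ultimately show ?thesis
    by (simp add: rows_below_def node residue_def e_def r_def)
qed

text \<open>Each application of \<open>jucys_murphy N\<close> exchanges \<open>N\<close> with one
  entry, so it changes the row of at most one entry other than \<open>N\<close>; subtracting a
  multiple of the previous element adds no tabloids beyond those already allowed.\<close>

lemma coef_iterate_moves_few:
  fixes y :: "nat \<Rightarrow> (tabloid \<Rightarrow>\<^sub>0 'a::field)"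
  assumes t: "is_tableau lam t" and y0: "y 0 = polytabloid lam t"
    and y: "\<And>k. y (Suc k) = act (y k) (jucys_murphy N) - scale_pm (c k) (y k)"
    and nz: "coef (y k) \<rho> \<noteq> 0"
  shows "\<exists>\<pi>\<in>column_perms. card {a \<in> {1..<N}. \<rho> a \<noteq> row_fun (t \<circ> \<pi>) a} \<le> k"
  using nz
proof (induction k arbitrary: \<rho>)
  case 0
  then have "icoef t \<rho> \<noteq> 0" by (auto simp: y0 coef_polytabloid[OF t])
  then obtain \<pi> where pi: "\<pi> \<in> column_perms" "fits (t \<circ> \<pi>) \<rho>" using icoef_nonzero by blast
  have "{a \<in> {1..<N}. \<rho> a \<noteq> row_fun (t \<circ> \<pi>) a} = {}"
    using fits_eq_on[OF tableau_comp_right[OF column_permsD(1)[OF pi(1)] t] pi(2)] by auto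
  then show ?case using pi(1) by (intro bexI[of _ \<pi>]) (simp_all only: card.empty le_refl)
next
  case (Suc k)
  show ?case
  proof (cases "coef (y k) \<rho> = 0")
    case False
    then show ?thesis using Suc.IH[of \<rho>] le_SucI by blast
  next
    case True
    then have "(\<Sum>i\<in>{1..<N}. coef (y k) (\<rho> \<circ> transpose i N)) \<noteq> 0"
      using Suc.prems by (simp add: y coef_diff coef_scale coef_act_jucys_murphy del: sum.op_ivl_Suc)
    then obtain i where i: "coef (y k) (\<rho> \<circ> transpose i N) \<noteq> 0"
      by (meson sum.neutral)
    obtain \<pi> where pi: "\<pi> \<in> column_perms"
      and card: "card {a \<in> {1..<N}. (\<rho> \<circ> transpose i N) a \<noteq> row_fun (t \<circ> \<pi>) a} \<le> k"
      using Suc.IH[OF i] by blast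
    have "{a \<in> {1..<N}. \<rho> a \<noteq> row_fun (t \<circ> \<pi>) a}
        \<subseteq> insert i {a \<in> {1..<N}. (\<rho> \<circ> transpose i N) a \<noteq> row_fun (t \<circ> \<pi>) a}"
      by (auto simp: transpose_def)
    then have "card {a \<in> {1..<N}. \<rho> a \<noteq> row_fun (t \<circ> \<pi>) a}
        \<le> card (insert i {a \<in> {1..<N}. (\<rho> \<circ> transpose i N) a \<noteq> row_fun (t \<circ> \<pi>) a})"
      by (intro card_mono) auto
    also have "\<dots> \<le> Suc (card {a \<in> {1..<N}. (\<rho> \<circ> transpose i N) a \<noteq> row_fun (t \<circ> \<pi>) a})"
      by (simp add: card_insert_if)
    also have "\<dots> \<le> Suc k" using card by simp
    finally show ?thesis using pi by blast
  qed
qed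

text \<open>
  Starting from \<open>N\<close> at \<open>q 0\<close>, exchange \<open>N\<close> successively with the entries at \<open>q 1, \<dots>, q d\<close>.
  All these nodes are at the bottom of distinct columns, so \<open>d\<close> exchanges are necessary,
  and they must take place in this order.
\<close>

primrec exchanged_rows :: "tableau \<Rightarrow> (nat \<Rightarrow> node) \<Rightarrow> nat \<Rightarrow> nat \<Rightarrow> nat" where
  "exchanged_rows t q 0 = row_fun t"
| "exchanged_rows t q (Suc k) = exchanged_rows t q k \<circ> transpose (t (q (Suc k))) N"

context
  fixes t :: tableau and q :: "nat \<Rightarrow> node" and d :: nat
  assumes t: "is_tableau lam t" and qD: "\<And>j. j \<le> d \<Longrightarrow> q j \<in> D"
    and q0: "t (q 0) = N"
    and bottom: "\<And>i j. j \<le> d \<Longrightarrow> (i, snd (q j)) \<in> D \<Longrightarrow> i \<le> fst (q j)"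
    and rows_less: "\<And>i j. i < j \<Longrightarrow> j \<le> d \<Longrightarrow> fst (q j) < fst (q i)"
begin

text \<open>Two of the nodes in one column would both be its foot, but their rows differ.\<close>

lemma columns_distinct:
  assumes "i \<le> d" "j \<le> d" "snd (q i) = snd (q j)"
  shows "i = j"
proof -
  have "(fst (q i), snd (q j)) \<in> D" "(fst (q j), snd (q i)) \<in> D"
    using qD[OF assms(1)] qD[OF assms(2)] assms(3) by (metis prod.collapse)+
  then have "fst (q i) = fst (q j)" using bottom assms(1,2) by (meson le_antisym)
  then show ?thesis
    using rows_less[of i j] rows_less[of j i] assms(1,2) by (cases i j rule: linorder_cases) auto
qed

lemma entry_eq_iff: "i \<le> d \<Longrightarrow> j \<le> d \<Longrightarrow> t (q i) = t (q j) \<longleftrightarrow> i = j"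
  using columns_distinct tableau_eq_iff[OF t qD qD] by metis

lemma entry_neq_N: "1 \<le> j \<Longrightarrow> j \<le> d \<Longrightarrow> t (q j) \<noteq> N"
  using entry_eq_iff[of j 0] q0 by simp

text \<open>The three facts need a joint induction: the next exchange gives \<open>N\<close> the row
  of the entry at \<open>q (Suc k)\<close>, which the earlier exchanges have not touched.\<close>

lemma exchanged_rows_N: "k \<le> d \<Longrightarrow> exchanged_rows t q k N = fst (q k)"
  and exchanged_rows_entry: "k \<le> d \<Longrightarrow> 1 \<le> j \<Longrightarrow> j \<le> k \<Longrightarrow> exchanged_rows t q k (t (q j)) = fst (q (j - 1))"
  and exchanged_rows_other: "k \<le> d \<Longrightarrow> a \<noteq> N \<Longrightarrow> (\<And>j. 1 \<le> j \<Longrightarrow> j \<le> k \<Longrightarrow> a \<noteq> t (q j))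
    \<Longrightarrow> exchanged_rows t q k a = row_fun t a"
proof (induction k arbitrary: j a)
  case 0
  { case 1 then show ?case using row_fun_apply[OF t qD[of 0]] q0 by simp }
  { case 2 then show ?case by simp }
  { case 3 then show ?case by simp }
next
  case (Suc k)
  { case 1
    then have "exchanged_rows t q k (t (q (Suc k))) = row_fun t (t (q (Suc k)))"
      using Suc.IH(3)[of "t (q (Suc k))"] entry_eq_iff[of "Suc k"] entry_neq_N[of "Suc k"] by simp
    then show ?case using row_fun_apply[OF t qD[OF 1]] by simp }
  { case 2
    then show ?case
      using Suc.IH(1) Suc.IH(2)[of j] entry_eq_iff[of j "Suc k"] entry_neq_N[of j]
      by (cases "j = Suc k") (simp_all add: transpose_def) }
  { case 3
    then show ?case using Suc.IH(3)[of j] by (simp add: transpose_def) }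
qed

text \<open>\<open>\<rho>\<close> is what remains after undoing a wrong last exchange, with
  \<open>i\<close> instead of the entry at \<open>q (Suc k)\<close>; \<open>i = N\<close> means that
  nothing is undone. Too many entries are then displaced for \<open>k\<close> steps to
  suffice.\<close>

lemma exchanges_necessary:
  assumes k: "Suc k \<le> d" and pi: "\<pi> \<in> column_perms" and i: "i \<noteq> t (q (Suc k))"
    and \<rho>: "\<And>a. a \<in> {1..<N} \<Longrightarrow> a \<noteq> i \<Longrightarrow> \<rho> a = exchanged_rows t q (Suc k) a"
    and \<rho>i: "i \<in> {1..<N} \<Longrightarrow> \<rho> i = fst (q (Suc k))"
  shows "card {a \<in> {1..<N}. \<rho> a \<noteq> row_fun (t \<circ> \<pi>) a} > k" (is "card ?B > k")
proof -
  let ?x = "\<lambda>j. t (q j)"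
  note perm = column_permsD(1)[OF pi] and col = column_permsD(2)[OF pi]
  have X: "is_tableau lam (t \<circ> \<pi>)" by (rule tableau_comp_right[OF perm t])
  have inj: "inj_on ?x {1..Suc k}" using entry_eq_iff k by (auto simp: inj_on_def)
  then have card: "card (?x ` {1..Suc k}) = Suc k" by (simp add: card_image)
  have xN: "?x j \<in> {1..<N}" if "j \<in> {1..Suc k}" for j
    using tableau_in[OF t qD[of j]] entry_neq_N[of j] that k by (auto simp: le_less)
  \<comment> \<open>Each \<open>q j\<close> is the foot of its column, so a column permutation can
    only raise its entry.\<close>
  have up: "row_fun (t \<circ> \<pi>) (?x j) \<le> fst (q j)" if j: "j \<in> {1..Suc k}" for j
  proof -
    have jd: "j \<le> d" using j k by simp
    obtain w where w: "w \<in> D" "\<pi> w = q j" using qD[OF jd] permutes_image[OF perm] by (metis imageE)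
    have "row_fun (t \<circ> \<pi>) (?x j) = fst w" using row_fun_apply[OF X w(1)] w(2) by simp
    then show ?thesis using bottom[OF jd, of "fst w"] col[of w] w by simp
  qed
  \<comment> \<open>In \<open>\<rho>\<close> this entry has the lower row of
    \<open>q (j - 1)\<close>, out of reach of column permutations.\<close>
  have moved: "?x j \<in> ?B" if j: "j \<in> {1..Suc k}" and "?x j \<noteq> i" for j
  proof -
    have "\<rho> (?x j) = fst (q (j - 1))" using \<rho>[OF xN[OF j]] exchanged_rows_entry[OF k, of j] that by simp
    moreover have "fst (q j) < fst (q (j - 1))" using rows_less[of "j - 1" j] j k by simp
    ultimately show ?thesis using up[OF j] xN[OF j] by simp
  qed
  have "\<exists>Y. Y \<subseteq> ?B \<and> card Y = Suc k"
  proof (cases "\<exists>j\<in>{1..Suc k}. i = ?x j")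
    case False
    then have "?x ` {1..Suc k} \<subseteq> ?B" by (intro image_subsetI moved) metis+
    then show ?thesis by (intro exI[of _ "?x ` {1..Suc k}"] conjI card)
  next
    case True
    then obtain j where j: "j \<in> {1..Suc k}" "i = ?x j" by blast
    then have jk: "j < Suc k" using i by (cases "j = Suc k") auto
    have jd: "j \<le> d" using j k by simp
    have \<rho>j: "\<rho> (?x j) = fst (q (Suc k))" using \<rho>i xN[OF j(1)] j(2) by simp
    \<comment> \<open>The entry \<open>i\<close> of \<open>q j\<close> now has a higher row, which
      \<open>\<pi>\<close> might account for. In that case it is replaced in the count by the entry
      \<open>w\<close> that \<open>\<pi>\<close> brings to \<open>q j\<close>, because
      \<open>\<rho>\<close> leaves \<open>w\<close> in its own row.\<close>
    define w where "w = t (\<pi> (q j))"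
    have piD: "\<pi> (q j) \<in> D" using permutes_in_image[OF perm] qD[OF jd] by blast
    have roww: "row_fun (t \<circ> \<pi>) w = fst (q j)"
      using row_fun_apply[OF X qD[OF jd]] by (simp add: w_def)
    show ?thesis
    proof (cases "\<pi> (q j) = q j")
      case True
      then have "?x j \<in> ?B" using roww \<rho>j rows_less[OF jk k] xN[OF j(1)] by (simp add: w_def)
      then have "?x ` {1..Suc k} \<subseteq> ?B"
        using moved j(2) by (intro image_subsetI) metis
      then show ?thesis by (intro exI[of _ "?x ` {1..Suc k}"] conjI card)
    next
      case False
      have wq: "w \<noteq> ?x j'" if "j' \<le> d" for j'
      proof
        assume "w = ?x j'"
        then have eq: "\<pi> (q j) = q j'" using tableau_eq_iff[OF t piD qD[OF that]] by (simp add: w_def)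
        then have "j = j'" using columns_distinct[OF jd that] col[of "q j"] by simp
        then show False using eq False by simp
      qed
      have wN: "w \<noteq> N" using wq[of 0] q0 by simp
      have w1: "w \<in> {1..<N}" using tableau_in[OF t piD] wN by (auto simp: w_def)
      have "\<rho> w = exchanged_rows t q (Suc k) w" using \<rho>[OF w1] wq[OF jd] j(2) by simp
      also have "\<dots> = row_fun t w" by (rule exchanged_rows_other[OF k wN]) (use wq k in simp)
      also have "\<dots> = fst (\<pi> (q j))" using row_fun_apply[OF t piD] by (simp add: w_def)
      finally have "\<rho> w \<noteq> fst (q j)" using False col[of "q j"] by (auto simp: prod_eq_iff)
      then have wB: "w \<in> ?B" using roww w1 by simp
      have wX: "w \<notin> ?x ` {1..Suc k}"
      proof
        assume "w \<in> ?x ` {1..Suc k}"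
        then obtain j' where "w = ?x j'" "j' \<le> Suc k" by auto
        then show False using wq[of j'] k by simp
      qed
      have "?x ` {1..Suc k} - {?x j} \<subseteq> ?B"
      proof
        fix a assume "a \<in> ?x ` {1..Suc k} - {?x j}"
        then obtain j' where "j' \<in> {1..Suc k}" "a = ?x j'" "?x j' \<noteq> i" using j(2) by auto
        then show "a \<in> ?B" using moved[of j'] by simp
      qed
      then have "insert w (?x ` {1..Suc k} - {?x j}) \<subseteq> ?B" by (rule insert_subsetI[OF wB])
      moreover have "card (insert w (?x ` {1..Suc k} - {?x j})) = Suc k"
        using wX card j(1) by (simp add: card_Diff_singleton)
      ultimately show ?thesis by (intro exI conjI)
    qed
  qed
  then obtain Y where "Y \<subseteq> ?B" "card Y = Suc k" by blast
  then show ?thesis using card_mono[of ?B Y] by simp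
qed

text \<open>The new coefficient collects the old ones at all tabloids obtained by exchanging
  \<open>N\<close> with some \<open>i\<close>; by the count, only the one undoing the last exchange
  contributes.\<close>

lemma coef_exchanged_rows:
  fixes y :: "nat \<Rightarrow> (tabloid \<Rightarrow>\<^sub>0 'a::field)"
  assumes y0: "y 0 = polytabloid lam t"
    and y: "\<And>k. y (Suc k) = act (y k) (jucys_murphy N) - scale_pm (c k) (y k)"
    and "k \<le> d"
  shows "coef (y k) (exchanged_rows t q k) = 1"
  using assms(3)
proof (induction k)
  case 0
  then show ?case by (simp add: y0 coef_polytabloid[OF t] icoef_self[OF t fits_row_fun[OF t]])
next
  case (Suc k)
  let ?R = "exchanged_rows t q (Suc k)"
  let ?x = "t (q (Suc k))"
  have zero: "coef (y k) \<rho> = 0" if "i \<noteq> ?x"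
    and "\<And>a. a \<in> {1..<N} \<Longrightarrow> a \<noteq> i \<Longrightarrow> \<rho> a = ?R a"
    and "i \<in> {1..<N} \<Longrightarrow> \<rho> i = fst (q (Suc k))" for i \<rho>
    using exchanges_necessary[OF Suc.prems _ that] coef_iterate_moves_few[where y = y and c = c, OF t y0 y]
    by (meson not_le)
  have x: "?x \<in> {1..<N}"
    using tableau_in[OF t qD[OF Suc.prems]] entry_neq_N[OF _ Suc.prems] by (auto simp: le_less)
  \<comment> \<open>The choice \<open>i = N\<close> lies outside \<open>{1..<N}\<close> and imposes
    agreement with \<open>?R\<close> throughout; this disposes of the scalar term.\<close>
  have "coef (y k) ?R = 0"
    using entry_neq_N[OF _ Suc.prems] by (intro zero[of N]) auto
  then have "coef (y (Suc k)) ?R = (\<Sum>i\<in>{1..<N}. coef (y k) (?R \<circ> transpose i N))"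
    by (simp add: y coef_diff coef_scale coef_act_jucys_murphy del: sum.op_ivl_Suc exchanged_rows.simps)
  also have "\<dots> = coef (y k) (?R \<circ> transpose ?x N)
      + (\<Sum>i\<in>{1..<N} - {?x}. coef (y k) (?R \<circ> transpose i N))"
    using x by (intro sum.remove) auto
  also have "(\<Sum>i\<in>{1..<N} - {?x}. coef (y k) (?R \<circ> transpose i N)) = 0"
  proof (intro sum.neutral ballI)
    fix i assume i: "i \<in> {1..<N} - {?x}"
    show "coef (y k) (?R \<circ> transpose i N) = 0"
      using i exchanged_rows_N[OF Suc.prems]
      by (intro zero[of i]) (auto simp del: exchanged_rows.simps)
  qed
  also have "?R \<circ> transpose ?x N = exchanged_rows t q k"
    by (simp add: o_assoc[symmetric])
  finally show ?case using Suc by simp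
qed

end

end

section \<open>Homomorphisms between consecutive quotients\<close>

text \<open>The map is defined through a chosen preimage under \<open>\<theta>\<close>. Two choices
  differ by an element of \<open>U'\<close>, which \<open>h\<close> sends into \<open>V'\<close>,
  the kernel of \<open>\<theta>'\<close>.\<close>

lemma induces_nonzero_hom_quotients:
  fixes U U' V V' M M' :: "(tabloid \<Rightarrow>\<^sub>0 'a::field) set"
  assumes h: "induces_nonzero_hom n U U' V V' h"
    and \<theta>: "identifies_quotient n U U' M \<theta>" and \<theta>': "identifies_quotient n V V' M' \<theta>'"
  shows "\<exists>\<phi>. sym_hom n M M' \<phi> \<and> (\<exists>y\<in>M. \<phi> y \<noteq> 0) \<and> (\<forall>x\<in>U. \<phi> (\<theta> x) = \<theta>' (h x))"
proof -
  have hU: "sym_hom n U V h" and hU': "sym_hom n U' V' h"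
    using h by (auto simp: induces_nonzero_hom_def)
  have tU: "sym_hom n U M \<theta>" "\<theta> ` U = M" "U' = {x \<in> U. \<theta> x = 0}"
    using \<theta> by (auto simp: identifies_quotient_def)
  have tV: "sym_hom n V M' \<theta>'" "V' = {x \<in> V. \<theta>' x = 0}"
    using \<theta>' by (auto simp: identifies_quotient_def)
  have U: "fvs.subspace U" and Uact: "\<And>x a. x \<in> U \<Longrightarrow> a \<in> sym_group_alg n \<Longrightarrow> act x a \<in> U"
    using hU by (auto simp: sym_hom_def sym_submodule_def)
  have h_in: "\<And>x. x \<in> U \<Longrightarrow> h x \<in> V" and h_in': "\<And>x. x \<in> U' \<Longrightarrow> h x \<in> V'"
    and h_add: "\<And>x y. x \<in> U \<Longrightarrow> y \<in> U \<Longrightarrow> h (x + y) = h x + h y"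
    and h_act: "\<And>x a. x \<in> U \<Longrightarrow> a \<in> sym_group_alg n \<Longrightarrow> h (act x a) = act (h x) a"
    using hU hU' by (auto simp: sym_hom_def)
  have t_add: "\<And>x y. x \<in> U \<Longrightarrow> y \<in> U \<Longrightarrow> \<theta> (x + y) = \<theta> x + \<theta> y"
    and t_act: "\<And>x a. x \<in> U \<Longrightarrow> a \<in> sym_group_alg n \<Longrightarrow> \<theta> (act x a) = act (\<theta> x) a"
    using tU by (auto simp: sym_hom_def)
  have t'_in: "\<And>x. x \<in> V \<Longrightarrow> \<theta>' x \<in> M'"
    and t'_add: "\<And>x y. x \<in> V \<Longrightarrow> y \<in> V \<Longrightarrow> \<theta>' (x + y) = \<theta>' x + \<theta>' y"
    and t'_act: "\<And>x a. x \<in> V \<Longrightarrow> a \<in> sym_group_alg n \<Longrightarrow> \<theta>' (act x a) = act (\<theta>' x) a"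
    using tV by (auto simp: sym_hom_def)
  define \<phi> where "\<phi> y = \<theta>' (h (SOME x. x \<in> U \<and> \<theta> x = y))" for y
  have phi: "\<phi> (\<theta> x) = \<theta>' (h x)" if x: "x \<in> U" for x
  proof -
    define x' where "x' = (SOME x'. x' \<in> U \<and> \<theta> x' = \<theta> x)"
    have x': "x' \<in> U" "\<theta> x' = \<theta> x"
      using someI[of "\<lambda>x'. x' \<in> U \<and> \<theta> x' = \<theta> x" x] x by (auto simp: x'_def)
    define d where "d = x - x'"
    have d: "d \<in> U" "x = d + x'" using fvs.subspace_diff[OF U x x'(1)] by (simp_all add: d_def)
    have "\<theta> d = 0" using t_add[OF d(1) x'(1)] d(2) x'(2) by simp
    then have dU': "d \<in> U'" using d(1) tU(3) by simp
    then have "\<theta>' (h d) = 0" using h_in'[OF dU'] tV(2) by simp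
    then have "\<theta>' (h x) = \<theta>' (h x')"
      unfolding d(2) using h_add[OF d(1) x'(1)] t'_add[OF h_in[OF d(1)] h_in[OF x'(1)]] by simp
    then show ?thesis by (simp add: \<phi>_def x'_def)
  qed
  have "sym_hom n M M' \<phi>"
    unfolding sym_hom_def
  proof (intro conjI ballI)
    show "sym_submodule n M" "sym_submodule n M'" using tU(1) tV(1) by (auto simp: sym_hom_def)
    show "\<phi> ` M \<subseteq> M'" using phi h_in t'_in tU(2) by auto
  next
    fix y z assume "y \<in> M" "z \<in> M"
    then obtain a b where ab: "y = \<theta> a" "a \<in> U" "z = \<theta> b" "b \<in> U" using tU(2) by blast
    then have "\<phi> (y + z) = \<phi> (\<theta> (a + b))" by (simp add: t_add)
    also have "\<dots> = \<phi> y + \<phi> z"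
      using ab phi h_add t'_add h_in fvs.subspace_add[OF U] by simp
    finally show "\<phi> (y + z) = \<phi> y + \<phi> z" .
  next
    fix y and a :: "'a group_alg" assume "y \<in> M" and a: "a \<in> sym_group_alg n"
    then obtain b where b: "y = \<theta> b" "b \<in> U" using tU(2) by blast
    then have "\<phi> (act y a) = \<phi> (\<theta> (act b a))" using a by (simp add: t_act)
    also have "\<dots> = act (\<phi> y) a" using b a phi Uact h_act t'_act h_in by simp
    finally show "\<phi> (act y a) = act (\<phi> y) a" .
  qed
  moreover have "\<exists>y\<in>M. \<phi> y \<noteq> 0"
  proof -
    obtain x where x: "x \<in> U" "h x \<notin> V'" using h by (auto simp: induces_nonzero_hom_def)
    then have "\<phi> (\<theta> x) \<noteq> 0" using phi h_in tV(2) by simp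
    then show ?thesis using x(1) tU(2) by blast
  qed
  ultimately show ?thesis using phi by blast
qed

section \<open>The polynomial and its effect on the Specht series\<close>

context young_diagram
begin

text \<open>The factors belong to the \<open>d\<close> removable nodes
  \<open>e, e - 1, ..., e - d + 1\<close>; the theorem uses \<open>e = u\<close> and
  \<open>d = u - v\<close>.\<close>

definition content_poly :: "nat \<Rightarrow> nat \<Rightarrow> 'a::field poly" where
  "content_poly e d = (\<Prod>j<d. [:- of_int (residue (removable_node lam (e - j))), 1:])"

lemma content_poly_0 [simp]: "content_poly e 0 = 1"
  by (simp add: content_poly_def)

lemma content_poly_Suc:
  "content_poly e (Suc d) = [:- of_int (residue (removable_node lam (e - d))), 1:] * content_poly e d"
  unfolding content_poly_def by (simp only: prod.lessThan_Suc mult.commute)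

text \<open>The two products share all factors except those of nodes \<open>e\<close> and
  \<open>e - d\<close>; this is where equality of the \<open>p\<close>-residues enters.\<close>

lemma content_poly_shift:
  assumes "d \<le> e" and "(of_int (residue (removable_node lam e)) :: 'a::field)
    = of_int (residue (removable_node lam (e - d)))"
  shows "(content_poly e d :: 'a poly) = content_poly (e - 1) d"
proof (cases d)
  case (Suc d')
  define g :: "nat \<Rightarrow> 'a poly" where "g j = [:- of_int (residue (removable_node lam j)), 1:]" for j
  have g: "content_poly e d = (\<Prod>j<d. g (e - j))" for e d by (simp add: content_poly_def g_def)
  have "content_poly e d = g e * (\<Prod>j<d'. g (e - Suc j))"
    unfolding g Suc by (subst prod.lessThan_Suc_shift) simp
  also have "g e = g (e - d)" using assms(2) by (simp add: g_def)
  also have "g (e - d) * (\<Prod>j<d'. g (e - Suc j)) = content_poly (e - 1) d"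
    unfolding g Suc by (simp add: mult.commute)
  finally show ?thesis .
qed simp

lemma specht_series_mono: "i \<le> j \<Longrightarrow> specht_series lam i \<subseteq> specht_series lam j"
  unfolding specht_series_def by (rule fvs.span_mono) fastforce

text \<open>A spanning polytabloid with \<open>N\<close> at the \<open>k\<close>-th removable node,
  \<open>k \<le> i\<close>, comes with the residue of node \<open>k\<close>. Replacing it by that of
  node \<open>i\<close> costs a multiple of the polytabloid, which for \<open>k < i\<close> already
  lies in the smaller subspace.\<close>

lemma jucys_murphy_specht_series:
  assumes i: "i \<in> {1..num_removable lam}" and "N > 0"
    and x: "(x :: tabloid \<Rightarrow>\<^sub>0 'a::field) \<in> specht_series lam i"
  shows "act x (jucys_murphy N) - scale_pm (of_int (residue (removable_node lam i))) x
    \<in> specht_series lam (i - 1)"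
  using x unfolding specht_series_def[of lam i]
proof (induction rule: fvs.span_induct_alt)
  case base
  then show ?case by (simp add: specht_series_def fvs.span_zero)
next
  case (step b y z)
  let ?S = "specht_series lam (i - 1) :: (tabloid \<Rightarrow>\<^sub>0 'a) set"
  let ?res = "\<lambda>k. of_int (residue (removable_node lam k)) :: 'a"
  have sub: "fvs.subspace ?S" by (simp add: specht_series_def fvs.subspace_span)
  obtain s k where s: "y = polytabloid lam s" "standard_tableau lam s"
    and k: "k \<in> {1..i}" "s (removable_node lam k) = N" using step(1) by auto
  have k': "k \<in> {1..num_removable lam}" using k(1) i by auto
  have tab: "is_tableau lam s" using s(2) by (simp add: standard_tableau_def)
  have "act y (jucys_murphy N) - scale_pm (?res k) y \<in> specht_series lam (k - 1)"
    using jucys_murphy_polytabloid[OF tab k' k(2)] unfolding s(1) specht_series_eq(2)[OF k' assms(2)] .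
  then have 1: "act y (jucys_murphy N) - scale_pm (?res k) y \<in> ?S"
    using specht_series_mono[of "k - 1" "i - 1"] k(1) by (auto intro: diff_le_mono)
  have 2: "scale_pm (?res k - ?res i) y \<in> ?S"
  proof (cases "k = i")
    case True
    then show ?thesis using fvs.subspace_0[OF sub] by (simp add: fvs.scale_zero_left)
  next
    case False
    then have "k \<in> {1..i - 1}" using k(1) by auto
    then have "\<exists>k\<in>{1..i - 1}. s (removable_node lam k) = card D" using k(2) by (intro bexI[of _ k]) simp_all
    then have "y \<in> ?S" unfolding specht_series_def using s by (intro fvs.span_base) blast
    then show ?thesis by (rule fvs.subspace_scale[OF sub])
  qed
  have "act y (jucys_murphy N) - scale_pm (?res i) y
      = (act y (jucys_murphy N) - scale_pm (?res k) y) + scale_pm (?res k - ?res i) y"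
    by (simp add: fvs.scale_left_diff_distrib)
  then have "act y (jucys_murphy N) - scale_pm (?res i) y \<in> ?S"
    by (simp only: fvs.subspace_add[OF sub 1 2])
  then have "scale_pm b (act y (jucys_murphy N) - scale_pm (?res i) y)
      + (act z (jucys_murphy N) - scale_pm (?res i) z) \<in> ?S"
    using step(2) by (intro fvs.subspace_add[OF sub] fvs.subspace_scale[OF sub])
  moreover have "scale_pm b (act y (jucys_murphy N) - scale_pm (?res i) y)
      + (act z (jucys_murphy N) - scale_pm (?res i) z)
    = act (scale_pm b y + z) (jucys_murphy N) - scale_pm (?res i) (scale_pm b y + z)"
    by (simp add: act_add_left act_scale_left fvs.scale_right_diff_distrib fvs.scale_right_distrib mult.commute)
  ultimately show ?case by simp
qed

lemma content_poly_specht_series: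
  assumes "d \<le> e" "e \<le> num_removable lam" "N > 0"
    and "(x :: tabloid \<Rightarrow>\<^sub>0 'a::field) \<in> specht_series lam e"
  shows "act x (ga_poly (content_poly e d) (jucys_murphy N)) \<in> specht_series lam (e - d)"
  using assms(1)
proof (induction d)
  case 0
  then show ?case using assms(4) by simp
next
  case (Suc d)
  then have "e - d \<in> {1..num_removable lam}" using assms(2) by auto
  from jucys_murphy_specht_series[OF this assms(3)] show ?case
    using Suc by (simp add: content_poly_Suc act_ga_poly_linear_factor del: mult_pCons_left)
qed

lemma tableau_with_largest_at:
  assumes "z \<in> D"
  obtains t where "is_tableau lam t" "t z = N"
proof -
  obtain h where h: "bij_betw h D {1..N}"
    using finite_same_card_bij[of D "{1..N}"] by auto
  define t where "t x = (if x \<in> D then transpose (h z) N (h x) else 0)" for x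
  have "h z \<in> {1..N}" using h assms by (auto simp: bij_betw_def)
  then have "transpose (h z) N permutes {1..N}" by (intro permutes_swap_id) auto
  then have "bij_betw (transpose (h z) N \<circ> h) D {1..N}"
    using bij_betw_trans[OF h permutes_imp_bij] by blast
  then have "bij_betw t D {1..N}"
    by (rule bij_betw_cong[THEN iffD1, rotated]) (simp add: t_def)
  then have "is_tableau lam t" by (simp add: is_tableau_def t_def)
  then show ?thesis using that assms by (simp add: t_def)
qed

lemma content_poly_nonzero:
  assumes v: "1 \<le> v" "v \<le> u" and u: "u \<le> num_removable lam" and "N > 0"
  shows "\<exists>x\<in>specht_series lam u.
    act x (ga_poly (content_poly u (u - v)) (jucys_murphy N)) \<notin> (specht_series lam (v - 1) :: (tabloid \<Rightarrow>\<^sub>0 'a::field) set)"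
proof -
  define d where "d = u - v"
  \<comment> \<open>The nodes are listed upwards, from the \<open>u\<close>-th removable node at
    index 0 to the \<open>v\<close>-th at index \<open>d\<close>, in the order in which
    \<open>N\<close> visits them.\<close>
  define q where "q j = removable_node lam (u - j)" for j
  have mem: "u - j \<in> {1..num_removable lam}" if "j \<le> d" for j using that v u by (auto simp: d_def)
  have fq: "fst (q j) = removable_row lam (u - j)" for j by (simp add: q_def removable_node_def)
  obtain t where t: "is_tableau lam t" "t (q 0) = N"
    using tableau_with_largest_at[OF removable_node_in[OF mem[of 0]]] by (auto simp: q_def)
  have qD: "q j \<in> D" if "j \<le> d" for j unfolding q_def by (rule removable_node_in[OF mem[OF that]])
  have bottom: "i \<le> fst (q j)" if "j \<le> d" "(i, snd (q j)) \<in> D" for i j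
    using removable_node_bottom[OF mem[OF that(1)]] that(2) unfolding q_def by (simp add: removable_node_def)
  have less: "fst (q j) < fst (q i)" if "i < j" "j \<le> d" for i j
    unfolding fq using that v u by (intro removable_row_less) (auto simp: d_def)
  define y where "y k = act (polytabloid lam t :: tabloid \<Rightarrow>\<^sub>0 'a) (ga_poly (content_poly u k) (jucys_murphy N))" for k
  have "coef (y d) (exchanged_rows t q d) = 1"
  proof (rule coef_exchanged_rows[where t = t and q = q and d = d and k = d and y = y
        and c = "\<lambda>k. of_int (residue (removable_node lam (u - k)))", OF t(1) qD t(2) bottom less])
    show "y 0 = polytabloid lam t" by (simp add: y_def)
    show "y (Suc k) = act (y k) (jucys_murphy N) - scale_pm (of_int (residue (removable_node lam (u - k)))) (y k)" for k
      by (simp add: y_def content_poly_Suc act_ga_poly_linear_factor del: mult_pCons_left)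
  qed simp_all
  moreover have "exchanged_rows t q d N = fst (q d)"
    by (rule exchanged_rows_N[where t = t and q = q and d = d, OF t(1) qD t(2) bottom less]) simp_all
  moreover have "fst (q d) = removable_row lam v" using v(2) by (simp add: fq d_def)
  \<comment> \<open>The coefficient 1 is at a tabloid with \<open>N\<close> in the row of the
    \<open>v\<close>-th removable node, the first row excluded by the threshold.\<close>
  ultimately have "y d \<notin> rows_below (removable_row lam v)"
    by (auto simp: rows_below_def intro!: exI[of _ "exchanged_rows t q d"])
  moreover have "specht_series lam (v - 1) = (rows_below (removable_row lam v) :: (tabloid \<Rightarrow>\<^sub>0 'a) set)"
    by (rule specht_series_eq(2)) (use v u assms(4) in auto)
  moreover have "(polytabloid lam t :: tabloid \<Rightarrow>\<^sub>0 'a) \<in> rows_below (Suc (removable_row lam u))"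
    by (rule polytabloid_in_rows_below[OF t(1) qD[of 0] t(2)]) (use bottom[of 0] fq[of 0] in force)+
  then have "(polytabloid lam t :: tabloid \<Rightarrow>\<^sub>0 'a) \<in> specht_series lam u"
    by (subst specht_series_eq(1)) (use v u assms(4) in auto)
  ultimately show ?thesis by (auto simp: y_def d_def)
qed

text \<open>For \<open>u < v\<close>, the rows down to that of the \<open>u\<close>-th removable
  node lose a node when the \<open>u\<close>-th is removed, but none when the \<open>v\<close>-th
  is.\<close>

lemma dominates_remove_node_imp_le:
  assumes "u \<in> {1..num_removable lam}" "v \<in> {1..num_removable lam}"
    and "dominates (remove_node lam u) (remove_node lam v)"
  shows "v \<le> u"
proof (rule ccontr)
  assume "\<not> v \<le> u"
  then have less: "removable_row lam u < removable_row lam v" using removable_row_less[of u v] assms by simp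
  let ?r = "removable_row lam u"
  have pos: "lam ?r > 0" using removable_row_mem[OF assms(1)] by (simp add: removable_rows_def)
  have "(\<Sum>i<Suc ?r. remove_node lam u i) < (\<Sum>i<Suc ?r. remove_node lam v i)"
  proof (rule sum_strict_mono_ex1)
    show "\<forall>i\<in>{..<Suc ?r}. remove_node lam u i \<le> remove_node lam v i"
      using less by (auto simp: remove_node_def)
    show "\<exists>i\<in>{..<Suc ?r}. remove_node lam u i < remove_node lam v i"
      using less pos by (intro bexI[of _ ?r]) (auto simp: remove_node_def)
  qed simp
  then show False using assms(3)[unfolded dominates_def, rule_format, of "Suc ?r"] by linarith
qed

end

theorem theorem1p1:
  fixes lam alpha beta :: "nat \<Rightarrow> nat" and n p u v :: nat
  assumes "CHAR('a::field) = p" and "p > 0"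
    and "partition_of (n + 1) lam"
    and "u \<in> {1..num_removable lam}" and "v \<in> {1..num_removable lam}"
    and "alpha = remove_node lam u" and "beta = remove_node lam v"
    and "dominates alpha beta"
    and "[residue (removable_node lam u) = residue (removable_node lam v)] (mod int p)"
  shows "\<exists>f :: 'a poly.
    (\<lambda>x. act x (ga_poly f (jucys_murphy (n + 1)))) ` specht_series lam u \<subseteq> specht_series lam v \<and>
    (\<lambda>x. act x (ga_poly f (jucys_murphy (n + 1)))) ` specht_series lam (u - 1)
      \<subseteq> specht_series lam (v - 1) \<and>
    induces_nonzero_hom n (specht_series lam u) (specht_series lam (u - 1))
      (specht_series lam v) (specht_series lam (v - 1))
      (\<lambda>x. act x (ga_poly f (jucys_murphy (n + 1)))) \<and>
    (\<forall>\<theta> \<theta>'.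
      identifies_quotient n (specht_series lam u) (specht_series lam (u - 1)) (specht alpha) \<theta> \<and>
      identifies_quotient n (specht_series lam v) (specht_series lam (v - 1)) (specht beta) \<theta>' \<longrightarrow>
      (\<exists>\<phi>. sym_hom n (specht alpha) (specht beta) \<phi> \<and> (\<exists>y\<in>specht alpha. \<phi> y \<noteq> 0) \<and>
        (\<forall>x\<in>specht_series lam u.
          \<phi> (\<theta> x) = \<theta>' (act x (ga_poly f (jucys_murphy (n + 1)))))))"
proof -
  interpret young_diagram lam "n + 1" by unfold_locales (rule assms(3))
  have vu: "v \<le> u" using dominates_remove_node_imp_le assms(4-8) by blast
  define d where "d = u - v"
  define f where "f = (content_poly u d :: 'a poly)"
  define h where "h x = act x (ga_poly f (jucys_murphy (n + 1)))" for x :: "tabloid \<Rightarrow>\<^sub>0 'a"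
  \<comment> \<open>Congruence modulo the characteristic is equality in the field.\<close>
  have "(of_int (residue (removable_node lam u)) :: 'a) = of_int (residue (removable_node lam v))"
    using assms(1,9) by (simp add: of_int_eq_iff_cong_CHAR)
  then have f': "f = content_poly (u - 1) d"
    unfolding f_def using vu by (intro content_poly_shift) (simp_all add: d_def)
  have im: "h ` specht_series lam u \<subseteq> specht_series lam v"
    using content_poly_specht_series[of d u] vu assms(4) by (auto simp: h_def f_def d_def)
  have im': "h ` specht_series lam (u - 1) \<subseteq> specht_series lam (v - 1)"
  proof (rule image_subsetI)
    fix x :: "tabloid \<Rightarrow>\<^sub>0 'a" assume "x \<in> specht_series lam (u - 1)"
    moreover have "d \<le> u - 1" "u - 1 \<le> num_removable lam" using vu assms(4,5) by (auto simp: d_def)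
    \<comment> \<open>On the smaller subspace the second factorization applies, with
      \<open>d\<close> factors starting from node \<open>u - 1\<close>.\<close>
    ultimately have "h x \<in> specht_series lam (u - 1 - d)"
      unfolding h_def f' by (intro content_poly_specht_series) simp_all
    moreover have "u - 1 - d = v - 1" using vu by (simp add: d_def)
    ultimately show "h x \<in> specht_series lam (v - 1)" by simp
  qed
  have sub: "sym_submodule n (specht_series lam i :: (tabloid \<Rightarrow>\<^sub>0 'a) set)"
    "sym_submodule n (specht_series lam (i - 1) :: (tabloid \<Rightarrow>\<^sub>0 'a) set)"
    if "i \<in> {1..num_removable lam}" for i
    by (subst specht_series_eq, use that in simp, simp, rule sym_submodule_rows_below, simp)+
  have hom: "sym_hom n U V h" if "sym_submodule n U" "sym_submodule n V" "h ` U \<subseteq> V" for U V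
    using that by (simp add: sym_hom_def h_def act_add_left act_ga_poly_commute[simplified])
  have "\<exists>x\<in>specht_series lam u. h x \<notin> specht_series lam (v - 1)"
    using content_poly_nonzero[of v u] vu assms(4,5) by (simp add: h_def f_def d_def)
  then have ind: "induces_nonzero_hom n (specht_series lam u) (specht_series lam (u - 1))
      (specht_series lam v) (specht_series lam (v - 1)) h"
    unfolding induces_nonzero_hom_def
    by (intro conjI hom sub[OF assms(4)] sub[OF assms(5)] im im' specht_series_mono diff_le_self)
  show ?thesis
  proof (intro exI[of _ f] conjI allI impI; fold h_def)
    fix \<theta> \<theta>' :: "(tabloid \<Rightarrow>\<^sub>0 'a) \<Rightarrow> (tabloid \<Rightarrow>\<^sub>0 'a)"
    assume "identifies_quotient n (specht_series lam u) (specht_series lam (u - 1)) (specht alpha) \<theta> \<and>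
      identifies_quotient n (specht_series lam v) (specht_series lam (v - 1)) (specht beta) \<theta>'"
    then show "\<exists>\<phi>. sym_hom n (specht alpha) (specht beta) \<phi> \<and> (\<exists>y\<in>specht alpha. \<phi> y \<noteq> 0) \<and>
        (\<forall>x\<in>specht_series lam u. \<phi> (\<theta> x) = \<theta>' (h x))"
      using induces_nonzero_hom_quotients[OF ind] by blast
  qed (fact im im' ind)+
qed

end
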